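(* Let $D>0$, let $F\in C^2(\mathbb{R})$ and $\gamma_*>0$ satisfy assumption (B) and let $\Gamma$ satisfy assumption (K) of the context. Fix $\gamma\in[0,\gamma_*]$ and $v\in\mathbb{R}$. Assume that $F_\gamma(u)=F(u)+\gamma u$ satisfies, with constants $\Phi_*,\Phi^*\in\mathbb{R}$, $$F_\gamma(u)\ge-\Phi_*\ \text{ for } u\in[u_-^\gamma,u_m^\gamma],\qquad F_\gamma(u)\le\Phi^*\ \text{ for } u\in[u_m^\gamma,u_+^\gamma],$$ that $a_*,b_*\in[u_m^\gamma,u_+^\gamma]$ with $a_*<b_*$ and $\alpha_*>0$ are such that $F_\gamma(u)\ge\alpha_*(u-a_* )$ for $u\in[a_*,b_*]$, and that $a^*,b^*\in[u_-^\gamma,u_m^\gamma]$ with $b^*<a^*$ and $\alpha^*>0$ are such that $F_\gamma(u)\le\alpha^*(u-a^* )$ for $u\in[b^*,a^*]$. Then the speed $C(\gamma,v)$ of the traveling front $U_{\gamma,v}$ (see context) satisfies: if $v\ge0$, $$-\max\Big\{\Big(\frac{\Phi^*D}{b^*-a^*}\Big)^{1/2}_{\!\!\star},\ \frac{\Phi^*\gamma\hat g_1 v}{\alpha^*(a^*-b^* )}\Big\}-\gamma\hat g_1v\ \le\ C(\gamma,v)\ \le\ \Big(\frac{\Phi_*D}{u_+^\gamma-u_m^\gamma}\Big)^{1/2},$$ where $\big(\frac{\Phi^*D}{b^*-a^*}\big)^{1/2}_{\star}:=\big(\frac{\Phi^*D}{a^*-b^*}\big)^{1/2}$; and if $v\le0$,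 $$-\Big(\frac{\Phi^*D}{u_m^\gamma-u_-^\gamma}\Big)^{1/2}\ \le\ C(\gamma,v)\ \le\ \max\Big\{\Big(\frac{\Phi_*D}{b_*-a_*}\Big)^{1/2},\ \frac{\Phi_*\gamma\hat g_1|v|}{\alpha_*(b_*-a_* )}\Big\}+\gamma\hat g_1|v| .$$
   Context: For $\gamma\in\mathbb{R}$ put $F_\gamma(u):=F(u)+\gamma u$. (B): $F\in C^2(\mathbb{R})$ and $\gamma_*>0$ are such that for all $\gamma\in[0,\gamma_*]$ the function $F_\gamma$ has exactly three zeros $u_-^\gamma<u_m^\gamma<u_+^\gamma$, and $F_\gamma'(u_-^\gamma)<0$, $F_\gamma'(u_m^\gamma)>0$, $F_\gamma'(u_+^\gamma)<0$. (K): $\Gamma\in C^0([0,\infty))$, $\Gamma(\tau)\ge0$ for all $\tau\ge0$, $\int_0^\infty\Gamma(\tau)\,d\tau=1$, and $\hat g_1:=\int_0^\infty\tau\,\Gamma(\tau)\,d\tau<\infty$. Traveling fronts and wave speed: for $\gamma\in[0,\gamma_*]$ and $v\in\mathbb{R}$ consider the auxiliary equation $$\dot u(t,x)=D\,u_{xx}(t,x)+F(u(t,x))+\gamma\int_0^\infty\Gamma(\tau)\,u(t,x+v\tau)\,d\tau .$$ Under (B) and (K) it has a traveling front $u(t,x)=U_{\gamma,v}(x-ct)$ with $U_{\gamma,v}\in C^2(\mathbb{R})$ and $U_{\gamma,v}(\xi)\to u_\pm^\gamma$ for $\xi\to\pm\infty$; its speed $c$ is unique and its profile is unique up to translation. One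 sets $C(\gamma,v):=c$. *)

theory Defs
  imports "HOL-Analysis.Analysis"
begin

definition C2 :: "(real \<Rightarrow> real) \<Rightarrow> bool" where
  "C2 f \<longleftrightarrow>
     (\<forall>x. f differentiable at x) \<and>
     (\<forall>x. deriv f differentiable at x) \<and>
     continuous_on UNIV (deriv (deriv f))"

definition shifted :: "(real \<Rightarrow> real) \<Rightarrow> real \<Rightarrow> real \<Rightarrow> real" where
  "shifted F \<gamma> u = F u + \<gamma> * u"

text \<open>
  The zeros \<open>u\<^sub>-\<^sup>\<gamma> < u\<^sub>m\<^sup>\<gamma> < u\<^sub>+\<^sup>\<gamma>\<close> are carried as
  functions of \<open>\<gamma>\<close>; on \<open>[0, \<gamma>\<^sub>*]\<close> the predicate determines them uniquely.
\<close>

definition bistable ::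
  "(real \<Rightarrow> real) \<Rightarrow> real \<Rightarrow> (real \<Rightarrow> real) \<Rightarrow> (real \<Rightarrow> real) \<Rightarrow> (real \<Rightarrow> real) \<Rightarrow> bool" where
  "bistable F \<gamma>_max u_minus u_mid u_plus \<longleftrightarrow>
     C2 F \<and> \<gamma>_max > 0 \<and>
     (\<forall>\<gamma>\<in>{0..\<gamma>_max}.
        {u. shifted F \<gamma> u = 0} = {u_minus \<gamma>, u_mid \<gamma>, u_plus \<gamma>} \<and>
        u_minus \<gamma> < u_mid \<gamma> \<and> u_mid \<gamma> < u_plus \<gamma> \<and>
        deriv (shifted F \<gamma>) (u_minus \<gamma>) < 0 \<and>
        deriv (shifted F \<gamma>) (u_mid \<gamma>) > 0 \<and>
        deriv (shifted F \<gamma>) (u_plus \<gamma>) < 0)"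

text \<open>
  Kernels are total functions on the reals, but only their values on
  \<open>[0, \<infinity>)\<close> are ever used.
\<close>

definition delay_kernel :: "(real \<Rightarrow> real) \<Rightarrow> bool" where
  "delay_kernel \<Gamma> \<longleftrightarrow>
     continuous_on {0..} \<Gamma> \<and>
     (\<forall>\<tau>\<ge>0. \<Gamma> \<tau> \<ge> 0) \<and>
     set_integrable lborel {0..} \<Gamma> \<and>
     (LBINT \<tau>:{0..}. \<Gamma> \<tau>) = 1 \<and>
     set_integrable lborel {0..} (\<lambda>\<tau>. \<tau> * \<Gamma> \<tau>)"

definition first_moment :: "(real \<Rightarrow> real) \<Rightarrow> real" where
  "first_moment \<Gamma> = (LBINT \<tau>:{0..}. \<tau> * \<Gamma> \<tau>)"

definition aux_solution ::
  "real \<Rightarrow> (real \<Rightarrow> real) \<Rightarrow> (real \<Rightarrow> real) \<Rightarrow> real \<Rightarrow> real \<Rightarrow> (real \<Rightarrow> real \<Rightarrow> real) \<Rightarrow> bool" where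
  "aux_solution D F \<Gamma> \<gamma> v u \<longleftrightarrow>
     (\<forall>t x. C2 (u t) \<and>
        set_integrable lborel {0..} (\<lambda>\<tau>. \<Gamma> \<tau> * u t (x + v * \<tau>)) \<and>
        ((\<lambda>s. u s x) has_real_derivative
           D * deriv (deriv (u t)) x + F (u t x)
             + \<gamma> * (LBINT \<tau>:{0..}. \<Gamma> \<tau> * u t (x + v * \<tau>))) (at t))"

text \<open>A front with profile \<open>U\<close> and speed \<open>c\<close>, connecting \<open>l\<close> at \<open>-\<infinity>\<close> to \<open>r\<close> at \<open>+\<infinity>\<close>.\<close>

definition traveling_front ::
  "real \<Rightarrow> (real \<Rightarrow> real) \<Rightarrow> (real \<Rightarrow> real) \<Rightarrow> real \<Rightarrow> real \<Rightarrow> real \<Rightarrow> real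
     \<Rightarrow> (real \<Rightarrow> real) \<Rightarrow> real \<Rightarrow> bool" where
  "traveling_front D F \<Gamma> \<gamma> v l r U c \<longleftrightarrow>
     C2 U \<and> (U \<longlongrightarrow> l) at_bot \<and> (U \<longlongrightarrow> r) at_top \<and>
     aux_solution D F \<Gamma> \<gamma> v (\<lambda>t x. U (x - c * t))"

text \<open>
  The speed \<open>C(\<gamma>, v)\<close>; meaningful when a front exists and all fronts from \<open>l\<close> to \<open>r\<close>
  have the same speed.
\<close>

definition wave_speed ::
  "real \<Rightarrow> (real \<Rightarrow> real) \<Rightarrow> (real \<Rightarrow> real) \<Rightarrow> real \<Rightarrow> real \<Rightarrow> real \<Rightarrow> real \<Rightarrow> real" where
  "wave_speed D F \<Gamma> \<gamma> v l r = (THE c. \<exists>U. traveling_front D F \<Gamma> \<gamma> v l r U c)"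

end

theory Submission
  imports Defs
begin

text \<open>
  In the moving frame a front with speed \<open>c\<close> solves \<open>D U'' + c U' + g(U) + \<gamma> N = 0\<close>, where
  \<open>g(u) = F(u) + \<gamma> u\<close> is bistable with zeros \<open>l < m < r\<close> and \<open>N\<close> is the average of \<open>U(x + v \<tau>)\<close> against
  the kernel, minus \<open>U(x)\<close>. Since the kernel and \<open>\<gamma>\<close> are nonnegative, the equation has a comparison
  principle.

  The speed is well defined because of a sliding argument (lemma \<open>sliding\<close>): a translate of one
  profile is moved until it touches another one from above, and then the two coincide by the strong
  maximum principle. Applied to a profile and itself this shows that every profile is
  nondecreasing (\<open>front_mono\<close>); with monotonicity at hand, it applies to profiles of two a priori different
  speeds and shows that the speeds agree (\<open>front_speed_unique\<close>).

  For \<open>v \<ge> 0\<close> monotonicity gives \<open>N \<ge> 0\<close>, so the nonlocal term only helps the upper bound, which comes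
  from estimating the slope at the point \<open>U = m\<close> from both sides (\<open>speed_le_of_nonneg_shift\<close>). For the
  lower bound \<open>N\<close> is at most \<open>v\<close> times the first moment of the kernel times \<open>sup U'\<close>. This yields an
  upper bound for the slope in terms of a large negative speed, and it contradicts the growth that the
  equation enforces in the \<open>(U, U')\<close> plane while \<open>U\<close> climbs through the interval on which \<open>g\<close> lies
  below a negative linear function (\<open>speed_ge_of_nonneg_shift\<close>). The reflection
  \<open>- U(- x)\<close> changes the signs of \<open>v\<close> and \<open>c\<close> and turns these two bounds into those for \<open>v \<le> 0\<close>.
\<close>

section \<open>Calculus on the real line\<close>

lemma attains_maximum_above_limits:
  fixes f :: "real \<Rightarrow> real"
  assumes cont: "continuous_on UNIV f" and bot: "(f \<longlongrightarrow> a) at_bot" and top: "(f \<longlongrightarrow> b) at_top"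
    and x: "a < f x" "b < f x"
  shows "\<exists>z. \<forall>y. f y \<le> f z"
proof -
  obtain A where A: "\<And>y. y \<le> A \<Longrightarrow> f y < f x"
    using order_tendstoD(2)[OF bot x(1)] by (auto simp: eventually_at_bot_linorder)
  obtain B where B: "\<And>y. y \<ge> B \<Longrightarrow> f y < f x"
    using order_tendstoD(2)[OF top x(2)] by (auto simp: eventually_at_top_linorder)
  have xAB: "x \<in> {A..B}" using A[of x] B[of x] by force
  obtain z where z: "z \<in> {A..B}" "\<And>y. y \<in> {A..B} \<Longrightarrow> f y \<le> f z"
    using continuous_attains_sup[of "{A..B}" f] xAB continuous_on_subset[OF cont] by auto
  have "f y \<le> f z" for y
  proof (cases "y \<in> {A..B}")
    case False
    then have "f y < f x" using A[of y] B[of y] by force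
    also have "\<dots> \<le> f z" using z(2)[OF xAB] .
    finally show ?thesis by simp
  qed (use z(2) in auto)
  then show ?thesis by blast
qed

lemma attains_minimum_below_limits:
  fixes f :: "real \<Rightarrow> real"
  assumes "continuous_on UNIV f" and "(f \<longlongrightarrow> a) at_bot" and "(f \<longlongrightarrow> b) at_top"
    and "f x < a" "f x < b"
  shows "\<exists>z. \<forall>y. f z \<le> f y"
proof -
  have "\<exists>z. \<forall>y. - f y \<le> - f z"
    by (rule attains_maximum_above_limits[of "\<lambda>y. - f y" "-a" "-b" x])
       (use assms in \<open>auto intro!: continuous_intros tendsto_intros\<close>)
  then show ?thesis by simp
qed

lemma derivatives_at_minimum:
  fixes f f' :: "real \<Rightarrow> real"
  assumes df: "\<And>x. (f has_real_derivative f' x) (at x)"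
    and d2f: "(f' has_real_derivative s) (at z)"
    and min: "\<And>y. f z \<le> f y"
  shows "f' z = 0" "s \<ge> 0"
proof -
  show z: "f' z = 0"
    using DERIV_local_min[OF df[of z], of 1] min by auto
  show "s \<ge> 0"
  proof (rule ccontr)
    assume "\<not> s \<ge> 0"
    then have "s < 0" by simp
    then obtain d where d: "d > 0" "\<And>h. h > 0 \<Longrightarrow> h < d \<Longrightarrow> f' (z + h) < f' z"
      using DERIV_neg_dec_right[OF d2f] by blast
    obtain y where y: "z < y" "y < z + d/2" "f (z + d/2) - f z = (z + d/2 - z) * f' y"
      using MVT2[of z "z + d/2" f f'] d(1) df by auto
    have "f' y < 0" using d(2)[of "y - z"] y z d(1) by auto
    then have "f (z + d/2) < f z" using y(3) d(1) mult_pos_neg[of "d/2" "f' y"] by auto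
    then show False using min[of "z + d/2"] by simp
  qed
qed

text \<open>
  Strong maximum principle in one dimension. The operator \<open>D \<partial>\<^sup>2 + c \<partial> - L\<close> factors as
  \<open>D (\<partial> - p) (\<partial> - q)\<close> with real \<open>p\<close>, \<open>q\<close>, since \<open>L \<ge> 0\<close>. A nonnegative supersolution has
  vanishing value and slope at an interior zero, and integrating the two first-order inequalities
  in turn, away from the zero, forces it to be nonpositive on both sides.
\<close>
lemma supersolution_touching_zero_vanishes:
  fixes W W' W'' :: "real \<Rightarrow> real"
  assumes D: "D > 0" and L: "L \<ge> 0"
    and dW: "\<And>x. (W has_real_derivative W' x) (at x)"
    and dW': "\<And>x. (W' has_real_derivative W'' x) (at x)"
    and nonneg: "\<And>x. W x \<ge> 0" and zero: "W z = 0"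
    and super: "\<And>x. D * W'' x + c * W' x \<le> L * W x"
  shows "W x = 0"
proof -
  define q where "q = (- c + sqrt (c\<^sup>2 + 4 * D * L)) / (2 * D)"
  define p where "p = (- c - sqrt (c\<^sup>2 + 4 * D * L)) / (2 * D)"
  have sum: "D * (p + q) = - c"
    using D by (simp add: p_def q_def field_simps)
  have sq: "(sqrt (c\<^sup>2 + 4 * D * L))\<^sup>2 = c\<^sup>2 + 4 * D * L"
    using D L by simp
  have "4 * D * D * p * q = c\<^sup>2 - (sqrt (c\<^sup>2 + 4 * D * L))\<^sup>2"
    using D by (simp add: p_def q_def field_simps power2_eq_square)
  then have "4 * D * (D * (p * q) + L) = 0"
    unfolding sq by (simp add: algebra_simps)
  then have prod: "D * (p * q) = - L" using D by simp
  define Z where "Z x = W' x - q * W x" for x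
  have dZ: "(Z has_real_derivative W'' x - q * W' x) (at x)" for x
    unfolding Z_def by (auto intro!: derivative_eq_intros dW dW')
  have Z_ineq: "W'' x - q * W' x - p * Z x \<le> 0" for x
  proof -
    have "D * (W'' x - q * W' x - p * Z x) = D * W'' x - (D * (p + q)) * W' x + (D * (p * q)) * W x"
      by (simp add: Z_def algebra_simps)
    also have "\<dots> \<le> 0" unfolding sum prod using super[of x] by simp
    finally show ?thesis using D by (simp add: mult_le_0_iff)
  qed
  have W'z: "W' z = 0"
    using derivatives_at_minimum(1)[OF dW dW'] nonneg zero by simp
  have Zz: "Z z = 0" using W'z zero by (simp add: Z_def)
  have EZ: "exp (- p * b) * Z b \<le> exp (- p * a) * Z a" if "a \<le> b" for a b
  proof (rule DERIV_nonpos_imp_nonincreasing[OF that])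
    fix x
    have "((\<lambda>x. exp (- p * x) * Z x) has_real_derivative exp (- p * x) * (W'' x - q * W' x - p * Z x)) (at x)"
      by (auto intro!: derivative_eq_intros dZ simp: algebra_simps)
    moreover have "exp (- p * x) * (W'' x - q * W' x - p * Z x) \<le> 0"
      using Z_ineq[of x] by (simp add: mult_le_0_iff)
    ultimately show "\<exists>y. ((\<lambda>x. exp (- p * x) * Z x) has_real_derivative y) (at x) \<and> y \<le> 0" by blast
  qed
  have dEW: "((\<lambda>x. exp (- q * x) * W x) has_real_derivative exp (- q * x) * Z x) (at x)" for x
    by (auto intro!: derivative_eq_intros dW simp: Z_def algebra_simps)
  have "W x \<le> 0"
  proof (cases "x \<ge> z")
    case True
    have "exp (- q * y) * Z y \<le> 0" if "z \<le> y" for y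
      using EZ[OF that] Zz by (simp add: mult_le_0_iff)
    then have "exp (- q * x) * W x \<le> exp (- q * z) * W z"
      by (intro DERIV_nonpos_imp_nonincreasing[OF True, where f = "\<lambda>x. exp (- q * x) * W x"])
         (blast intro: dEW)
    then show ?thesis using zero by (simp add: mult_le_0_iff)
  next
    case False
    then have "x \<le> z" by simp
    have "exp (- q * y) * Z y \<ge> 0" if "y \<le> z" for y
      using EZ[OF that] Zz by (simp add: zero_le_mult_iff)
    then have "exp (- q * x) * W x \<le> exp (- q * z) * W z"
      by (intro DERIV_nonneg_imp_nondecreasing[OF \<open>x \<le> z\<close>, where f = "\<lambda>x. exp (- q * x) * W x"])
         (blast intro: dEW)
    then show ?thesis using zero by (simp add: mult_le_0_iff)
  qed
  then show ?thesis using nonneg[of x] by simp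
qed

section \<open>Averages against the delay kernel\<close>

lemma kernel_affine:
  assumes "delay_kernel \<Gamma>"
  shows "set_integrable lborel {0..} (\<lambda>\<tau>. \<Gamma> \<tau> * (a + b * \<tau>))"
    and "(LBINT \<tau>:{0..}. \<Gamma> \<tau> * (a + b * \<tau>)) = a + b * first_moment \<Gamma>"
proof -
  have i: "set_integrable lborel {0..} \<Gamma>" "set_integrable lborel {0..} (\<lambda>\<tau>. \<tau> * \<Gamma> \<tau>)"
    and one: "(LBINT \<tau>:{0..}. \<Gamma> \<tau>) = 1"
    using assms by (auto simp: delay_kernel_def)
  have eq: "(\<lambda>\<tau>. \<Gamma> \<tau> * (a + b * \<tau>)) = (\<lambda>\<tau>. a * \<Gamma> \<tau> + b * (\<tau> * \<Gamma> \<tau>))"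
    by (auto simp: algebra_simps)
  have ia: "set_integrable lborel {0..} (\<lambda>\<tau>. a * \<Gamma> \<tau>)"
    and ib: "set_integrable lborel {0..} (\<lambda>\<tau>. b * (\<tau> * \<Gamma> \<tau>))"
    using i by auto
  show "set_integrable lborel {0..} (\<lambda>\<tau>. \<Gamma> \<tau> * (a + b * \<tau>))"
    unfolding eq by (rule set_integral_add[OF ia ib])
  show "(LBINT \<tau>:{0..}. \<Gamma> \<tau> * (a + b * \<tau>)) = a + b * first_moment \<Gamma>"
    unfolding eq by (subst set_integral_add(2)[OF ia ib]) (simp add: one first_moment_def)
qed

lemma kernel_average_mono:
  assumes "delay_kernel \<Gamma>"
    and "set_integrable lborel {0..} (\<lambda>\<tau>. \<Gamma> \<tau> * h \<tau>)" "set_integrable lborel {0..} (\<lambda>\<tau>. \<Gamma> \<tau> * k \<tau>)"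
    and "\<And>\<tau>. \<tau> \<ge> 0 \<Longrightarrow> h \<tau> \<le> k \<tau>"
  shows "(LBINT \<tau>:{0..}. \<Gamma> \<tau> * h \<tau>) \<le> (LBINT \<tau>:{0..}. \<Gamma> \<tau> * k \<tau>)"
  using assms by (intro set_integral_mono) (auto intro!: mult_left_mono simp: delay_kernel_def)

lemma kernel_average_ge:
  assumes "delay_kernel \<Gamma>" "set_integrable lborel {0..} (\<lambda>\<tau>. \<Gamma> \<tau> * h \<tau>)"
    and "\<And>\<tau>. \<tau> \<ge> 0 \<Longrightarrow> a + b * \<tau> \<le> h \<tau>"
  shows "a + b * first_moment \<Gamma> \<le> (LBINT \<tau>:{0..}. \<Gamma> \<tau> * h \<tau>)"
  using kernel_average_mono[OF assms(1) kernel_affine(1)[OF assms(1), of a b] assms(2)] assms(3)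
  by (simp add: kernel_affine(2)[OF assms(1)])

lemma kernel_average_le:
  assumes "delay_kernel \<Gamma>" "set_integrable lborel {0..} (\<lambda>\<tau>. \<Gamma> \<tau> * h \<tau>)"
    and "\<And>\<tau>. \<tau> \<ge> 0 \<Longrightarrow> h \<tau> \<le> a + b * \<tau>"
  shows "(LBINT \<tau>:{0..}. \<Gamma> \<tau> * h \<tau>) \<le> a + b * first_moment \<Gamma>"
  using kernel_average_mono[OF assms(1) assms(2) kernel_affine(1)[OF assms(1), of a b]] assms(3)
  by (simp add: kernel_affine(2)[OF assms(1)])

lemma first_moment_nonneg: "delay_kernel \<Gamma> \<Longrightarrow> first_moment \<Gamma> \<ge> 0"
  unfolding first_moment_def set_lebesgue_integral_def
  by (intro integral_nonneg_AE AE_I2) (auto simp: delay_kernel_def indicator_def)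

section \<open>The profile equation\<close>

text \<open>
  The equation is written in the moving frame, with the reaction \<open>g(u) = F(u) + \<gamma> u\<close>: the nonlocal
  term then appears as the average of \<open>U\<close> minus \<open>U\<close>, which vanishes on constants and has the sign of
  \<open>v\<close> once \<open>U\<close> is monotone. The derivatives are parameters, so that translated and reflected
  profiles are again of this form.
\<close>
definition profile ::
  "real \<Rightarrow> real \<Rightarrow> real \<Rightarrow> (real \<Rightarrow> real) \<Rightarrow> (real \<Rightarrow> real) \<Rightarrow> real \<Rightarrow> real \<Rightarrow> real
     \<Rightarrow> (real \<Rightarrow> real) \<Rightarrow> (real \<Rightarrow> real) \<Rightarrow> (real \<Rightarrow> real) \<Rightarrow> bool" where
  "profile D \<gamma> v \<Gamma> g l r c U U' U'' \<longleftrightarrow>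
     (\<forall>x. (U has_real_derivative U' x) (at x)) \<and>
     (\<forall>x. (U' has_real_derivative U'' x) (at x)) \<and>
     (U \<longlongrightarrow> l) at_bot \<and> (U \<longlongrightarrow> r) at_top \<and>
     (\<forall>x. set_integrable lborel {0..} (\<lambda>\<tau>. \<Gamma> \<tau> * U (x + v * \<tau>))) \<and>
     (\<forall>x. D * U'' x + c * U' x + g (U x)
            + \<gamma> * ((LBINT \<tau>:{0..}. \<Gamma> \<tau> * U (x + v * \<tau>)) - U x) = 0)"

lemma traveling_front_profile:
  assumes "traveling_front D F \<Gamma> \<gamma> v l r U c"
  shows "profile D \<gamma> v \<Gamma> (shifted F \<gamma>) l r c U (deriv U) (deriv (deriv U))"
proof -
  have C2: "C2 U" and lim: "(U \<longlongrightarrow> l) at_bot" "(U \<longlongrightarrow> r) at_top"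
    and aux: "aux_solution D F \<Gamma> \<gamma> v (\<lambda>t x. U (x - c * t))"
    using assms by (auto simp: traveling_front_def)
  have d: "(U has_real_derivative deriv U x) (at x)" for x
    using C2 by (simp add: C2_def DERIV_deriv_iff_real_differentiable)
  have d2: "(deriv U has_real_derivative deriv (deriv U) x) (at x)" for x
    using C2 by (simp add: C2_def DERIV_deriv_iff_real_differentiable)
  have int: "set_integrable lborel {0..} (\<lambda>\<tau>. \<Gamma> \<tau> * U (x + v * \<tau>))" for x
    using aux[unfolded aux_solution_def, rule_format, of 0 x] by simp
  have eq: "D * deriv (deriv U) x + c * deriv U x + shifted F \<gamma> (U x)
      + \<gamma> * ((LBINT \<tau>:{0..}. \<Gamma> \<tau> * U (x + v * \<tau>)) - U x) = 0" for x
  proof -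
    have "((\<lambda>s. U (x - c * s)) has_real_derivative
        D * deriv (deriv U) x + F (U x) + \<gamma> * (LBINT \<tau>:{0..}. \<Gamma> \<tau> * U (x + v * \<tau>))) (at 0)"
      using aux[unfolded aux_solution_def, rule_format, of 0 x] by simp
    moreover have "((\<lambda>s. U (x - c * s)) has_real_derivative deriv U (x - c * 0) * (- c)) (at 0)"
      by (rule DERIV_chain2[where f = U and g = "\<lambda>s. x - c * s"], rule d) (auto intro!: derivative_eq_intros)
    ultimately have "D * deriv (deriv U) x + F (U x) + \<gamma> * (LBINT \<tau>:{0..}. \<Gamma> \<tau> * U (x + v * \<tau>))
        = deriv U x * (- c)"
      by (metis DERIV_unique mult_zero_right diff_zero)
    then show ?thesis by (simp add: shifted_def algebra_simps)
  qed
  show ?thesis unfolding profile_def using d d2 lim int eq by blast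
qed

lemma profile_reflect:
  assumes "profile D \<gamma> v \<Gamma> g l r c U U' U''"
  shows "profile D \<gamma> (- v) \<Gamma> (\<lambda>u. - g (- u)) (- r) (- l) (- c)
           (\<lambda>x. - U (- x)) (\<lambda>x. U' (- x)) (\<lambda>x. - U'' (- x))"
proof -
  have d: "(U has_real_derivative U' x) (at x)" and d2: "(U' has_real_derivative U'' x) (at x)"
    and int: "set_integrable lborel {0..} (\<lambda>\<tau>. \<Gamma> \<tau> * U (x + v * \<tau>))"
    and eq: "D * U'' x + c * U' x + g (U x)
            + \<gamma> * ((LBINT \<tau>:{0..}. \<Gamma> \<tau> * U (x + v * \<tau>)) - U x) = 0" for x
    using assms by (auto simp: profile_def)
  have lim: "(U \<longlongrightarrow> l) at_bot" "(U \<longlongrightarrow> r) at_top"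
    using assms by (auto simp: profile_def)
  have flip: "\<Gamma> \<tau> * - U (- (x + - v * \<tau>)) = - (\<Gamma> \<tau> * U (- x + v * \<tau>))" for x \<tau>
    by (simp add: algebra_simps)
  show ?thesis unfolding profile_def flip
  proof (intro conjI allI)
    fix x
    show "((\<lambda>x. - U (- x)) has_real_derivative U' (- x)) (at x)"
      using DERIV_minus[OF DERIV_chain2[OF d[of "- x"] DERIV_minus[OF DERIV_ident]]] by simp
    show "((\<lambda>x. U' (- x)) has_real_derivative - U'' (- x)) (at x)"
      using DERIV_chain2[OF d2[of "- x"] DERIV_minus[OF DERIV_ident]] by simp
    show "set_integrable lborel {0..} (\<lambda>\<tau>. - (\<Gamma> \<tau> * U (- x + v * \<tau>)))"
      using int[of "- x"] by (simp add: set_integrable_def)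
    have "(LBINT \<tau>:{0..}. - (\<Gamma> \<tau> * U (- x + v * \<tau>))) = - (LBINT \<tau>:{0..}. \<Gamma> \<tau> * U (- x + v * \<tau>))"
      by (simp add: set_lebesgue_integral_def)
    then show "D * - U'' (- x) + - c * U' (- x) + - g (- (- U (- x))) +
         \<gamma> * ((LBINT \<tau>:{0..}. - (\<Gamma> \<tau> * U (- x + v * \<tau>))) - (- U (- x))) = 0"
      using eq[of "- x"] by (simp add: algebra_simps)
  next
    show "((\<lambda>x. - U (- x)) \<longlongrightarrow> - r) at_bot"
      by (intro tendsto_minus filterlim_compose[OF lim(2)] filterlim_uminus_at_top_at_bot)
    show "((\<lambda>x. - U (- x)) \<longlongrightarrow> - l) at_top"
      by (intro tendsto_minus filterlim_compose[OF lim(1)] filterlim_uminus_at_bot_at_top)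
  qed
qed

text \<open>
  On the stable zones of width \<open>\<delta>\<close> next to \<open>l\<close> and \<open>r\<close> the reaction is strictly decreasing, so that the
  maximum principle holds for pairs of values in the same zone. Elsewhere only the Lipschitz constant
  \<open>L\<close> controls differences. The conditions are symmetric under \<open>g(u) \<mapsto> - g(- u)\<close>, which exchanges the
  roles of \<open>l\<close> and \<open>r\<close> and reverses the signs of \<open>v\<close> and \<open>c\<close>.
\<close>
locale bistable_waves =
  fixes D \<gamma> v :: real and \<Gamma> g :: "real \<Rightarrow> real" and l m r \<delta> L :: real
  assumes D_pos: "D > 0" and \<gamma>_nonneg: "\<gamma> \<ge> 0" and kernel: "delay_kernel \<Gamma>"
    and lm: "l < m" and mr: "m < r"
    and g_l: "g l = 0" and g_r: "g r = 0"
    and g_below: "\<And>u. u < l \<Longrightarrow> g u > 0" and g_above: "\<And>u. r < u \<Longrightarrow> g u < 0"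
    and g_left: "\<And>u. l \<le> u \<Longrightarrow> u \<le> m \<Longrightarrow> g u \<le> 0"
    and g_right: "\<And>u. m \<le> u \<Longrightarrow> u \<le> r \<Longrightarrow> g u \<ge> 0"
    and \<delta>_pos: "\<delta> > 0"
    and g_stable_left: "\<And>x y. l \<le> x \<Longrightarrow> x < y \<Longrightarrow> y \<le> l + \<delta> \<Longrightarrow> g y < g x"
    and g_stable_right: "\<And>x y. r - \<delta> \<le> x \<Longrightarrow> x < y \<Longrightarrow> y \<le> r \<Longrightarrow> g y < g x"
    and L_nonneg: "L \<ge> 0"
    and g_lipschitz: "\<And>x y. l \<le> x \<Longrightarrow> x \<le> y \<Longrightarrow> y \<le> r \<Longrightarrow> \<bar>g y - g x\<bar> \<le> L * (y - x)"
begin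

abbreviation "front \<equiv> profile D \<gamma> v \<Gamma> g l r"

lemma reflected: "bistable_waves D \<gamma> \<Gamma> (\<lambda>u. - g (- u)) (- r) (- m) (- l) \<delta> L"
proof unfold_locales
  fix x y assume "- r \<le> x" "x \<le> y" "y \<le> - l"
  then show "\<bar>- g (- y) - - g (- x)\<bar> \<le> L * (y - x)"
    using g_lipschitz[of "-y" "-x"] by simp
next
  fix x y assume "- r \<le> x" "x < y" "y \<le> - r + \<delta>"
  then show "- g (- y) < - g (- x)" using g_stable_right[of "-y" "-x"] by simp
next
  fix x y assume "- l - \<delta> \<le> x" "x < y" "y \<le> - l"
  then show "- g (- y) < - g (- x)" using g_stable_left[of "-y" "-x"] by simp
next
  fix u show "- m \<le> u \<Longrightarrow> u \<le> - l \<Longrightarrow> 0 \<le> - g (- u)" using g_left[of "-u"] by simp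
  show "- r \<le> u \<Longrightarrow> u \<le> - m \<Longrightarrow> - g (- u) \<le> 0" using g_right[of "-u"] by simp
  show "u < - r \<Longrightarrow> 0 < - g (- u)" using g_above[of "-u"] by simp
  show "- l < u \<Longrightarrow> - g (- u) < 0" using g_below[of "-u"] by simp
qed (use D_pos \<gamma>_nonneg kernel lm mr g_l g_r \<delta>_pos L_nonneg in auto)

lemma
  assumes "front c U U' U''"
  shows front_deriv: "(U has_real_derivative U' x) (at x)"
    and front_deriv2: "(U' has_real_derivative U'' x) (at x)"
    and front_at_bot: "(U \<longlongrightarrow> l) at_bot"
    and front_at_top: "(U \<longlongrightarrow> r) at_top"
    and front_integrable: "set_integrable lborel {0..} (\<lambda>\<tau>. \<Gamma> \<tau> * U (x + v * \<tau>))"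
    and front_equation: "D * U'' x + c * U' x + g (U x)
      + \<gamma> * ((LBINT \<tau>:{0..}. \<Gamma> \<tau> * U (x + v * \<tau>)) - U x) = 0"
  using assms by (auto simp: profile_def)

lemma front_continuous: "front c U U' U'' \<Longrightarrow> continuous_on S U"
  by (meson DERIV_continuous_on front_deriv has_field_derivative_at_within)

text \<open>
  At a minimum below \<open>l\<close> no term of the equation is negative, and the reaction is positive.
\<close>
lemma front_ge:
  assumes f: "front c U U' U''"
  shows "l \<le> U x"
proof (rule ccontr)
  assume "\<not> l \<le> U x"
  then have x: "U x < l" "U x < r" using lm mr by auto
  from attains_minimum_below_limits[OF front_continuous[OF f] front_at_bot[OF f] front_at_top[OF f] x]
  obtain z where "\<forall>y. U z \<le> U y" ..
  then have z: "U z \<le> U y" for y ..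
  have "U' z = 0" "U'' z \<ge> 0"
    by (rule derivatives_at_minimum[OF front_deriv[OF f] front_deriv2[OF f] z])+
  moreover have "g (U z) > 0" using g_below z[of x] x by force
  moreover have "(LBINT \<tau>:{0..}. \<Gamma> \<tau> * U (z + v * \<tau>)) \<ge> U z"
    using kernel_average_ge[OF kernel front_integrable[OF f], of "U z" 0] z by simp
  ultimately have "D * U'' z + c * U' z + g (U z)
      + \<gamma> * ((LBINT \<tau>:{0..}. \<Gamma> \<tau> * U (z + v * \<tau>)) - U z) > 0"
    using D_pos \<gamma>_nonneg by (simp add: add_nonneg_pos add_pos_nonneg)
  then show False using front_equation[OF f, of z] by simp
qed

lemma front_le:
  assumes f: "front c U U' U''"
  shows "U x \<le> r"
  using bistable_waves.front_ge[OF reflected profile_reflect[OF f], of "- x"] by simp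

section \<open>Sliding: monotonicity and uniqueness of the speed\<close>

text \<open>
  Maximum principle for the difference of two profiles: at a negative minimum the slopes agree, so
  every term of the difference of the two equations is nonnegative, and the reaction term is
  positive. The hypothesis on \<open>(c\<^sub>2 - c\<^sub>1) U\<^sub>2'\<close> holds trivially for equal speeds, and for
  \<open>c\<^sub>1 < c\<^sub>2\<close> once \<open>U\<^sub>2\<close> is known to be monotone.
\<close>
lemma comparison:
  assumes f1: "front c1 U1 U1' U1''" and f2: "front c2 U2 U2' U2''"
    and ord: "\<And>x. (c2 - c1) * U2' x \<ge> 0"
    and decr: "\<And>x. U2 (x + s) < U1 x \<Longrightarrow> g (U1 x) < g (U2 (x + s))"
  shows "U1 x \<le> U2 (x + s)"
proof (rule ccontr)
  define W where "W x = U2 (x + s) - U1 x" for x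
  assume "\<not> U1 x \<le> U2 (x + s)"
  then have x: "W x < 0" by (simp add: W_def)
  have dW: "(W has_real_derivative U2' (x + s) - U1' x) (at x)" for x
    unfolding W_def using front_deriv[OF f2, of "x + s"] front_deriv[OF f1, of x]
    by (intro DERIV_diff) (simp_all add: DERIV_shift)
  have dW': "((\<lambda>x. U2' (x + s) - U1' x) has_real_derivative U2'' (x + s) - U1'' x) (at x)" for x
    using front_deriv2[OF f2, of "x + s"] front_deriv2[OF f1, of x]
    by (intro DERIV_diff) (simp_all add: DERIV_shift)
  have "filterlim (\<lambda>x. s + x) at_bot at_bot"
    by (rule filterlim_tendsto_add_at_bot_iff[OF tendsto_const, THEN iffD2, OF filterlim_ident])
  moreover have "filterlim (\<lambda>x. s + x) at_top at_top"
    by (rule filterlim_tendsto_add_at_top[OF tendsto_const filterlim_ident])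
  ultimately have shift: "filterlim (\<lambda>x. x + s) at_bot at_bot" "filterlim (\<lambda>x. x + s) at_top at_top"
    by (simp_all add: add.commute)
  have bot: "(W \<longlongrightarrow> l - l) at_bot" unfolding W_def
    by (intro tendsto_diff front_at_bot[OF f1] filterlim_compose[OF front_at_bot[OF f2]] shift)
  have top: "(W \<longlongrightarrow> r - r) at_top" unfolding W_def
    by (intro tendsto_diff front_at_top[OF f1] filterlim_compose[OF front_at_top[OF f2]] shift)
  have cont: "continuous_on UNIV W"
    by (meson DERIV_continuous_on dW has_field_derivative_at_within)
  have "W x < l - l" "W x < r - r" using x by simp_all
  from attains_minimum_below_limits[OF cont bot top this]
  obtain z where "\<forall>y. W z \<le> W y" ..
  then have z: "W z \<le> W y" for y ..
  have slope: "U2' (z + s) - U1' z = 0" and curv: "U2'' (z + s) - U1'' z \<ge> 0"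
    by (rule derivatives_at_minimum[OF dW dW' z])+
  have react: "g (U2 (z + s)) > g (U1 z)"
    using decr[of z] z[of x] x by (simp add: W_def)
  have "(LBINT \<tau>:{0..}. \<Gamma> \<tau> * U1 (z + v * \<tau>)) + W z
      = (LBINT \<tau>:{0..}. \<Gamma> \<tau> * U1 (z + v * \<tau>)) + (LBINT \<tau>:{0..}. \<Gamma> \<tau> * (W z + 0 * \<tau>))"
    by (simp only: kernel_affine(2)[OF kernel])
  also have "\<dots> = (LBINT \<tau>:{0..}. \<Gamma> \<tau> * U1 (z + v * \<tau>) + \<Gamma> \<tau> * (W z + 0 * \<tau>))"
    by (rule set_integral_add(2)[symmetric, OF front_integrable[OF f1] kernel_affine(1)[OF kernel]])
  also have "\<dots> = (LBINT \<tau>:{0..}. \<Gamma> \<tau> * (U1 (z + v * \<tau>) + W z))"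
    by (simp add: algebra_simps)
  also have "\<dots> \<le> (LBINT \<tau>:{0..}. \<Gamma> \<tau> * U2 (z + s + v * \<tau>))"
  proof (rule kernel_average_mono[OF kernel])
    show "set_integrable lborel {0..} (\<lambda>\<tau>. \<Gamma> \<tau> * (U1 (z + v * \<tau>) + W z))"
      using set_integral_add(1)[OF front_integrable[OF f1, of z] kernel_affine(1)[OF kernel, of "W z" 0]]
      by (simp add: algebra_simps)
    show "U1 (z + v * \<tau>) + W z \<le> U2 (z + s + v * \<tau>)" for \<tau>
      using z[of "z + v * \<tau>"] by (simp add: W_def algebra_simps)
  qed (rule front_integrable[OF f2])
  finally have avg: "0 \<le> ((LBINT \<tau>:{0..}. \<Gamma> \<tau> * U2 (z + s + v * \<tau>)) - U2 (z + s))
      - ((LBINT \<tau>:{0..}. \<Gamma> \<tau> * U1 (z + v * \<tau>)) - U1 z)" (is "0 \<le> ?N2 - ?N1")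
    by (simp add: W_def)
  have "D * (U2'' (z + s) - U1'' z) + (c2 - c1) * U2' (z + s) + (g (U2 (z + s)) - g (U1 z))
      + \<gamma> * (?N2 - ?N1) = 0"
    using front_equation[OF f1, of z] front_equation[OF f2, of "z + s"] slope
    by (simp add: algebra_simps)
  moreover have "D * (U2'' (z + s) - U1'' z) \<ge> 0" using curv D_pos by simp
  moreover have "\<gamma> * (?N2 - ?N1) \<ge> 0" using avg \<gamma>_nonneg by simp
  ultimately show False using ord[of "z + s"] react by linarith
qed

text \<open>
  The difference of the two profiles is a supersolution of a linear local equation: the average
  of the difference is nonnegative and can be dropped. What remains of the nonlocal term is \<open>- \<gamma>\<close> times
  the difference, and so the zeroth-order constant is \<open>L + \<gamma>\<close>.
\<close>
lemma touching_profiles_coincide: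
  assumes f1: "front c1 U1 U1' U1''" and f2: "front c2 U2 U2' U2''"
    and ord: "\<And>x. (c2 - c1) * U2' x \<ge> 0"
    and le: "\<And>x. U1 x \<le> U2 (x + s)" and touch: "U1 z = U2 (z + s)"
  shows "U1 x = U2 (x + s)"
proof -
  have "U2 (x + s) - U1 x = 0"
  proof (rule supersolution_touching_zero_vanishes[where W = "\<lambda>x. U2 (x + s) - U1 x" and z = z and L = "L + \<gamma>"
        and D = D and c = c1 and W' = "\<lambda>x. U2' (x + s) - U1' x" and W'' = "\<lambda>x. U2'' (x + s) - U1'' x"])
    fix x
    show "((\<lambda>x. U2 (x + s) - U1 x) has_real_derivative U2' (x + s) - U1' x) (at x)"
      using front_deriv[OF f2, of "x + s"] front_deriv[OF f1, of x]
      by (intro DERIV_diff) (simp_all add: DERIV_shift)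
    show "((\<lambda>x. U2' (x + s) - U1' x) has_real_derivative U2'' (x + s) - U1'' x) (at x)"
      using front_deriv2[OF f2, of "x + s"] front_deriv2[OF f1, of x]
      by (intro DERIV_diff) (simp_all add: DERIV_shift)
    have "(LBINT \<tau>:{0..}. \<Gamma> \<tau> * U1 (x + v * \<tau>)) \<le> (LBINT \<tau>:{0..}. \<Gamma> \<tau> * U2 (x + s + v * \<tau>))"
      (is "?A1 \<le> ?A2")
    proof (rule kernel_average_mono[OF kernel front_integrable[OF f1] front_integrable[OF f2]])
      show "U1 (x + v * \<tau>) \<le> U2 (x + s + v * \<tau>)" for \<tau>
        using le[of "x + v * \<tau>"] by (simp add: algebra_simps)
    qed
    then have avg: "\<gamma> * (?A2 - ?A1) \<ge> 0" using \<gamma>_nonneg by simp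
    have lip: "\<bar>g (U2 (x + s)) - g (U1 x)\<bar> \<le> L * (U2 (x + s) - U1 x)"
      using front_ge[OF f1] front_le[OF f2] le by (intro g_lipschitz) auto
    have eq: "D * (U2'' (x + s) - U1'' x) + c1 * (U2' (x + s) - U1' x) + (c2 - c1) * U2' (x + s)
      + (g (U2 (x + s)) - g (U1 x)) + \<gamma> * (?A2 - ?A1) = \<gamma> * (U2 (x + s) - U1 x)"
      using front_equation[OF f1, of x] front_equation[OF f2, of "x + s"]
      by (simp add: algebra_simps)
    then show "D * (U2'' (x + s) - U1'' x) + c1 * (U2' (x + s) - U1' x) \<le> (L + \<gamma>) * (U2 (x + s) - U1 x)"
      using avg lip ord[of "x + s"] by (simp add: algebra_simps)
  qed (use D_pos L_nonneg \<gamma>_nonneg le touch in auto)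
  then show ?thesis by simp
qed

text \<open>
  Sliding: \<open>U\<^sub>2(\<sqdot> + \<sigma>) \<ge> U\<^sub>1\<close> holds for large \<open>\<sigma>\<close> by the comparison principle,
  because wherever it failed both values would lie in the same stable zone. At the least shift \<open>s\<close> down to which it
  persists the two graphs touch: otherwise the gap would be positive on a compact set outside of
  which both values stay in the stable zones, and by the comparison principle a slightly smaller
  shift would still do. By the strong maximum principle touching profiles coincide.
\<close>
lemma sliding:
  assumes f1: "front c1 U1 U1' U1''" and f2: "front c2 U2 U2' U2''"
    and ord: "\<And>x. (c2 - c1) * U2' x \<ge> 0"
  shows "\<exists>s. (\<forall>x. U1 x = U2 (x + s)) \<and> (\<forall>\<sigma>\<ge>s. \<forall>x. U1 x \<le> U2 (x + \<sigma>))"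
proof -
  have lr: "l < r" using lm mr by simp
  have lU: "l < l + \<delta>" and rU: "r - \<delta> < r" using \<delta>_pos by auto
  obtain A where A: "\<And>y. y \<le> A \<Longrightarrow> U1 y < l + \<delta>" "\<And>y. y \<le> A \<Longrightarrow> U2 y < l + \<delta>"
    using eventually_conj[OF order_tendstoD(2)[OF front_at_bot[OF f1] lU]
        order_tendstoD(2)[OF front_at_bot[OF f2] lU]]
    by (auto simp: eventually_at_bot_linorder)
  obtain B where B: "\<And>y. y \<ge> B \<Longrightarrow> r - \<delta> < U1 y" "\<And>y. y \<ge> B \<Longrightarrow> r - \<delta> < U2 y"
    using eventually_conj[OF order_tendstoD(1)[OF front_at_top[OF f1] rU]
        order_tendstoD(1)[OF front_at_top[OF f2] rU]]
    by (auto simp: eventually_at_top_linorder)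
  have stable: "g (U1 x) < g (U2 y)" if "U2 y < U1 x" "x \<le> A \<or> y \<ge> B" for x y
    using that(2)
  proof
    assume "x \<le> A"
    then show ?thesis
      using g_stable_left[of "U2 y" "U1 x"] A(1)[of x] that(1) front_ge[OF f2, of y] by force
  next
    assume "y \<ge> B"
    then show ?thesis
      using g_stable_right[of "U2 y" "U1 x"] B(2)[of y] that(1) front_le[OF f1, of x] by force
  qed
  define S where "S = {s. \<forall>\<sigma>\<ge>s. \<forall>x. U1 x \<le> U2 (x + \<sigma>)}"
  have "B - A \<in> S"
    unfolding S_def
  proof (intro CollectI allI impI)
    fix \<sigma> x assume "B - A \<le> \<sigma>"
    then show "U1 x \<le> U2 (x + \<sigma>)"
      by (intro comparison[OF f1 f2 ord] stable) auto
  qed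
  then have S_ne: "S \<noteq> {}" by auto
  obtain x0 where x0: "U1 x0 > (l + r) / 2"
    using order_tendstoD(1)[OF front_at_top[OF f1], of "(l + r) / 2"] lr
    by (auto simp: eventually_at_top_linorder)
  obtain y0 where y0: "\<And>y. y \<le> y0 \<Longrightarrow> U2 y < (l + r) / 2"
    using order_tendstoD(2)[OF front_at_bot[OF f2], of "(l + r) / 2"] lr
    by (auto simp: eventually_at_bot_linorder)
  have "y0 - x0 \<le> s" if "s \<in> S" for s
  proof (rule ccontr)
    assume "\<not> y0 - x0 \<le> s"
    then have "U2 (x0 + s) < (l + r) / 2" by (intro y0) simp
    moreover have "U1 x0 \<le> U2 (x0 + s)" using that by (simp add: S_def)
    ultimately show False using x0 by simp
  qed
  then have S_bdd: "bdd_below S" by (rule bdd_belowI)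
  define s where "s = Inf S"
  have above: "U1 x \<le> U2 (x + \<sigma>)" if "s < \<sigma>" for \<sigma> x
    using cInf_lessD[OF S_ne that[unfolded s_def]] by (auto simp: S_def)
  have at_s: "U1 x \<le> U2 (x + s)" for x
  proof (rule tendsto_lowerbound)
    show "((\<lambda>\<sigma>. U2 (x + \<sigma>)) \<longlongrightarrow> U2 (x + s)) (at_right s)"
      by (intro isCont_tendsto_compose[OF DERIV_isCont[OF front_deriv[OF f2]]] tendsto_intros)
    show "\<forall>\<^sub>F \<sigma> in at_right s. U1 x \<le> U2 (x + \<sigma>)"
      using eventually_at_right_less[of s] by (rule eventually_mono) (rule above)
  qed simp
  have "\<exists>z. U1 z = U2 (z + s)"
  proof (rule ccontr)
    assume "\<not> (\<exists>z. U1 z = U2 (z + s))"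
    then have gap: "U1 x < U2 (x + s)" for x using at_s[of x] by (auto simp: order.strict_iff_order)
    define a where "a = min A (A - s)"
    define b where "b = max (max B (B - s + 1)) a"
    obtain \<mu> where \<mu>: "\<mu> > 0" "\<And>x. x \<in> {a..b} \<Longrightarrow> U2 (x + s) - U1 x \<ge> \<mu>"
    proof -
      have "continuous_on {a..b} (\<lambda>x. U2 (x + s) - U1 x)"
        by (intro continuous_intros front_continuous[OF f1]
            continuous_on_compose2[OF front_continuous[OF f2, of UNIV]]) auto
      then obtain z where "z \<in> {a..b}" "\<And>x. x \<in> {a..b} \<Longrightarrow> U2 (z + s) - U1 z \<le> U2 (x + s) - U1 x"
        using continuous_attains_inf[of "{a..b}" "\<lambda>x. U2 (x + s) - U1 x"] by (auto simp: b_def)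
      then show ?thesis using that[of "U2 (z + s) - U1 z"] gap[of z] by auto
    qed
    have "uniformly_continuous_on {a + s - 1..b + s} U2"
      by (intro compact_uniformly_continuous front_continuous[OF f2]) simp
    then obtain d where d: "d > 0"
      "\<And>x y. x \<in> {a + s - 1..b + s} \<Longrightarrow> y \<in> {a + s - 1..b + s} \<Longrightarrow> \<bar>y - x\<bar> < d \<Longrightarrow> \<bar>U2 y - U2 x\<bar> < \<mu>"
      unfolding uniformly_continuous_on_def dist_real_def using \<mu>(1) by blast
    define e where "e = min 1 (d / 2)"
    have e: "0 < e" "e \<le> 1" "e < d" using d(1) by (auto simp: e_def)
    have "U1 x \<le> U2 (x + \<sigma>)" if "s - e \<le> \<sigma>" for \<sigma> x
    proof (cases "s \<le> \<sigma>")
      case True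
      then show ?thesis using above[of \<sigma> x] at_s[of x] by (cases "s = \<sigma>") auto
    next
      case False
      show ?thesis
      proof (rule comparison[OF f1 f2 ord])
        fix x assume lt: "U2 (x + \<sigma>) < U1 x"
        have "x \<notin> {a..b}"
        proof
          assume x: "x \<in> {a..b}"
          have "\<bar>U2 (x + s) - U2 (x + \<sigma>)\<bar> < \<mu>"
            using x that False e by (intro d(2)) auto
          then show False using \<mu>(2)[OF x] lt by linarith
        qed
        then show "g (U1 x) < g (U2 (x + \<sigma>))"
          using that e by (intro stable[OF lt]) (auto simp: a_def b_def)
      qed
    qed
    then have "s - e \<in> S" by (simp add: S_def)
    then show False using cInf_lower[OF _ S_bdd, of "s - e"] e(1) by (simp add: s_def)
  qed
  then obtain z where z: "U1 z = U2 (z + s)" by blast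
  have "U1 x = U2 (x + s)" for x
    by (rule touching_profiles_coincide[OF f1 f2 ord at_s z])
  moreover have "U1 x \<le> U2 (x + \<sigma>)" if "s \<le> \<sigma>" for \<sigma> x
    using above[of \<sigma> x] at_s[of x] that by (cases "s = \<sigma>") auto
  ultimately show ?thesis by blast
qed

lemma front_not_constant:
  assumes f: "front c U U' U''"
  shows "\<exists>x. U x \<noteq> a"
proof (rule ccontr)
  assume "\<not> (\<exists>x. U x \<noteq> a)"
  then have "U = (\<lambda>_. a)" by auto
  then have "((\<lambda>_::real. a) \<longlongrightarrow> l) at_bot" "((\<lambda>_::real. a) \<longlongrightarrow> r) at_top"
    using front_at_bot[OF f] front_at_top[OF f] by simp_all
  then have "a = l" "a = r" by (auto simp: tendsto_const_iff)
  then show False using lm mr by simp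
qed

text \<open>
  A profile slid against itself: the extremal shift would be a period, and a nonzero period is
  incompatible with two different limits.
\<close>
lemma front_mono:
  assumes f: "front c U U' U''"
  shows "mono U"
proof -
  have "0 \<le> (c - c) * U' x" for x by simp
  from sliding[OF f f this] obtain s
    where slid: "(\<forall>x. U x = U (x + s)) \<and> (\<forall>\<sigma>\<ge>s. \<forall>x. U x \<le> U (x + \<sigma>))" ..
  note s = slid[THEN conjunct1, rule_format] slid[THEN conjunct2, rule_format]
  have per: "U (x + real n * s) = U x" for n x
  proof (induction n)
    case (Suc n)
    then show ?case using s(1)[of "x + real n * s"] by (simp add: algebra_simps)
  qed simp
  have "s = 0"
  proof (rule ccontr)
    assume "s \<noteq> 0"
    have per_abs: "U (x + real n * \<bar>s\<bar>) = U x" for n x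
      using per[of x n] per[of "x + real n * \<bar>s\<bar>" n] by (cases "s \<ge> 0") simp_all
    have "U x = r" for x
    proof -
      have "filterlim (\<lambda>n. x + real n * \<bar>s\<bar>) at_top sequentially"
        using \<open>s \<noteq> 0\<close> by (intro filterlim_tendsto_add_at_top[OF tendsto_const]
            filterlim_at_top_mult_tendsto_pos[OF tendsto_const] filterlim_real_sequentially) simp
      then have "((\<lambda>n. U (x + real n * \<bar>s\<bar>)) \<longlongrightarrow> r) sequentially"
        by (rule filterlim_compose[OF front_at_top[OF f]])
      then show ?thesis by (simp add: per_abs LIMSEQ_const_iff)
    qed
    then show False using front_not_constant[OF f] by metis
  qed
  show ?thesis
  proof (rule monoI)
    fix x y :: real
    assume "x \<le> y"
    then show "U x \<le> U y" using s(2)[of "y - x" x] \<open>s = 0\<close> by simp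
  qed
qed

lemma front_deriv_nonneg:
  assumes f: "front c U U' U''"
  shows "U' x \<ge> 0"
proof (rule ccontr)
  assume "\<not> U' x \<ge> 0"
  then obtain d where "d > 0" "\<And>h. h > 0 \<Longrightarrow> h < d \<Longrightarrow> U (x + h) < U x"
    using DERIV_neg_dec_right[OF front_deriv[OF f, of x]] by auto
  then have "U (x + d / 2) < U x" by simp
  moreover have "U x \<le> U (x + d / 2)" using monoD[OF front_mono[OF f]] \<open>d > 0\<close> by simp
  ultimately show False by simp
qed

text \<open>
  If the speeds differ, the faster profile can be slid onto the slower one, since its slope is
  nonnegative; the difference of the two equations then leaves \<open>(c\<^sub>2 - c\<^sub>1) U\<^sub>2' = 0\<close>.
\<close>
lemma front_speed_unique:
  assumes "front c1 U1 U1' U1''" and "front c2 U2 U2' U2''"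
  shows "c1 = c2"
proof -
  have no: False if f1: "front c1 U1 U1' U1''" and f2: "front c2 U2 U2' U2''" and less: "c1 < c2"
    for c1 c2 U1 U1' U1'' U2 U2' U2''
  proof -
    have "0 \<le> (c2 - c1) * U2' x" for x
      using front_deriv_nonneg[OF f2, of x] less by simp
    from sliding[OF f1 f2 this] obtain s where s: "\<And>x. U1 x = U2 (x + s)" by blast
    have d1: "U1' x = U2' (x + s)" for x
    proof (rule DERIV_unique[OF front_deriv[OF f1]])
      have "((\<lambda>x. U2 (x + s)) has_real_derivative U2' (x + s)) (at x)"
        using front_deriv[OF f2, of "x + s"] by (simp add: DERIV_shift)
      then show "(U1 has_real_derivative U2' (x + s)) (at x)" by (simp add: s[abs_def])
    qed
    have d2: "U1'' x = U2'' (x + s)" for x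
    proof (rule DERIV_unique[OF front_deriv2[OF f1]])
      have "((\<lambda>x. U2' (x + s)) has_real_derivative U2'' (x + s)) (at x)"
        using front_deriv2[OF f2, of "x + s"] by (simp add: DERIV_shift)
      then show "(U1' has_real_derivative U2'' (x + s)) (at x)" by (simp add: d1[abs_def])
    qed
    have "U2' (x + s) = 0" for x
    proof -
      have avg: "(LBINT \<tau>:{0..}. \<Gamma> \<tau> * U1 (x + v * \<tau>)) = (LBINT \<tau>:{0..}. \<Gamma> \<tau> * U2 (x + s + v * \<tau>))"
        by (simp add: s algebra_simps)
      have "c2 * U2' (x + s) = c1 * U2' (x + s)"
        using front_equation[OF f1, of x, unfolded avg, unfolded s d1 d2] front_equation[OF f2, of "x + s"]
        by linarith
      then show ?thesis using less by simp
    qed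
    then have "\<And>y. (U2 has_real_derivative 0) (at y)"
      using front_deriv[OF f2] by (metis diff_add_cancel)
    then have "U2 y = U2 0" for y
      using DERIV_isconst_all[of U2] by blast
    then show False using front_not_constant[OF f2] by blast
  qed
  show ?thesis using no[OF assms] no[OF assms(2,1)] by force
qed

section \<open>Speed estimates\<close>

lemma front_attains:
  assumes f: "front c U U' U''" and w: "l < w" "w < r"
  shows "\<exists>x. U x = w"
proof -
  obtain x where "U x < w"
    using order_tendstoD(2)[OF front_at_bot[OF f] w(1)] by (auto simp: eventually_at_bot_linorder)
  moreover obtain y where "w < U y"
    using order_tendstoD(1)[OF front_at_top[OF f] w(2)] by (auto simp: eventually_at_top_linorder)
  moreover have "connected (range U)"
    by (intro connected_continuous_image front_continuous[OF f] connected_UNIV)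
  ultimately have "w \<in> range U"
    using connectedD_interval[of "range U" "U x" "U y" w] by simp
  then show ?thesis by auto
qed

lemma front_average_bounds:
  assumes f: "front c U U' U''"
  shows "l \<le> (LBINT \<tau>:{0..}. \<Gamma> \<tau> * U (x + v * \<tau>))" "(LBINT \<tau>:{0..}. \<Gamma> \<tau> * U (x + v * \<tau>)) \<le> r"
  using kernel_average_ge[OF kernel front_integrable[OF f], where a = l and b = 0]
    kernel_average_le[OF kernel front_integrable[OF f], where a = r and b = 0] front_ge[OF f] front_le[OF f]
  by simp_all

text \<open>
  By the equation \<open>D U' + c U\<close> is Lipschitz, and on every unit interval \<open>U'\<close> takes a value of at most
  \<open>r - l\<close>.
\<close>
lemma front_deriv_bounded:
  assumes f: "front c U U' U''"
  shows "\<exists>M. \<forall>x. U' x \<le> M"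
proof -
  define B where "B = L * (r - l) + \<gamma> * (r - l)"
  have lr: "l < r" using lm mr by simp
  have bound: "\<bar>D * U'' x + c * U' x\<bar> \<le> B" for x
  proof -
    have "\<bar>g (U x) - g l\<bar> \<le> L * (U x - l)"
      by (rule g_lipschitz) (use front_ge[OF f] front_le[OF f] in auto)
    also have "\<dots> \<le> L * (r - l)" using front_le[OF f, of x] L_nonneg by (intro mult_left_mono) auto
    finally have 1: "\<bar>g (U x)\<bar> \<le> L * (r - l)" using g_l by simp
    have "\<bar>(LBINT \<tau>:{0..}. \<Gamma> \<tau> * U (x + v * \<tau>)) - U x\<bar> \<le> r - l" (is "\<bar>?N\<bar> \<le> _")
      using front_average_bounds[OF f, of x] front_ge[OF f, of x] front_le[OF f, of x] by linarith
    then have "\<gamma> * \<bar>?N\<bar> \<le> \<gamma> * (r - l)" using \<gamma>_nonneg by (intro mult_left_mono)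
    then have "\<bar>\<gamma> * ?N\<bar> \<le> \<gamma> * (r - l)" using \<gamma>_nonneg by (simp add: abs_mult)
    then show ?thesis using front_equation[OF f, of x] 1 unfolding B_def by linarith
  qed
  have dH: "((\<lambda>x. D * U' x + c * U x) has_real_derivative D * U'' x + c * U' x) (at x)" for x
    by (auto intro!: derivative_eq_intros front_deriv[OF f] front_deriv2[OF f])
  have "U' x \<le> (D * (r - l) + \<bar>c\<bar> * (r - l) + B) / D" for x
  proof -
    obtain y where y: "x < y" "y < x + 1" "U (x + 1) - U x = (x + 1 - x) * U' y"
      using MVT2[of x "x + 1" U U'] front_deriv[OF f] by auto
    have "U' y \<le> r - l" using y(3) front_le[OF f, of "x + 1"] front_ge[OF f, of x] by simp
    then have 1: "D * U' y \<le> D * (r - l)" using D_pos by (intro mult_left_mono) auto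
    obtain t where t: "x < t" "t < y"
      "(D * U' y + c * U y) - (D * U' x + c * U x) = (y - x) * (D * U'' t + c * U' t)"
      using MVT2[OF y(1), of "\<lambda>x. D * U' x + c * U x" "\<lambda>t. D * U'' t + c * U' t", OF dH] by blast
    have "\<bar>(y - x) * (D * U'' t + c * U' t)\<bar> \<le> 1 * B"
      unfolding abs_mult by (intro mult_mono bound) (use y in auto)
    then have 2: "D * U' x + c * U x \<le> D * U' y + c * U y + B" using t(3) by linarith
    have "c * (U y - U x) \<le> \<bar>c\<bar> * \<bar>U y - U x\<bar>" by (metis abs_ge_self abs_mult)
    also have "\<dots> \<le> \<bar>c\<bar> * (r - l)"
      using front_ge[OF f, of x] front_ge[OF f, of y] front_le[OF f, of x] front_le[OF f, of y]
      by (intro mult_left_mono) auto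
    finally have "D * U' x \<le> D * (r - l) + \<bar>c\<bar> * (r - l) + B"
      using 1 2 by (simp add: algebra_simps)
    then show ?thesis using D_pos by (simp add: pos_le_divide_eq mult.commute)
  qed
  then show ?thesis by blast
qed

lemma g_m: "g m = 0"
  using g_left[of m] g_right[of m] lm mr by simp

end

text \<open>
  The exponentially weighted function \<open>exp (p x) f x\<close> decreases, and it tends to \<open>0\<close> at \<open>-\<infinity>\<close> unless
  \<open>f\<close> is unbounded above.
\<close>
lemma bounded_subsolution_nonpos_left:
  fixes f f' :: "real \<Rightarrow> real"
  assumes p: "p > 0" and df: "\<And>x. (f has_real_derivative f' x) (at x)"
    and sub: "\<And>x. x \<le> z \<Longrightarrow> f' x + p * f x \<le> 0" and bdd: "\<And>x. f x \<le> M"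
  shows "f z \<le> 0"
proof -
  have "exp (p * z) * f z \<le> exp (p * y) * M" if "y \<le> z" for y
  proof -
    have "exp (p * z) * f z \<le> exp (p * y) * f y"
    proof (rule DERIV_nonpos_imp_nonincreasing[OF that])
      fix x assume x: "y \<le> x" "x \<le> z"
      have "((\<lambda>x. exp (p * x) * f x) has_real_derivative exp (p * x) * (f' x + p * f x)) (at x)"
        by (auto intro!: derivative_eq_intros df simp: algebra_simps)
      moreover have "exp (p * x) * (f' x + p * f x) \<le> 0"
        using sub[OF x(2)] by (simp add: mult_le_0_iff)
      ultimately show "\<exists>d. ((\<lambda>x. exp (p * x) * f x) has_real_derivative d) (at x) \<and> d \<le> 0" by blast
    qed
    also have "\<dots> \<le> exp (p * y) * M" using bdd by simp
    finally show ?thesis .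
  qed
  then have ev: "\<forall>\<^sub>F y in at_bot. exp (p * z) * f z \<le> exp (p * y) * M"
    by (auto simp: eventually_at_bot_linorder)
  have "filterlim (\<lambda>y. p * y) at_bot at_bot"
    by (rule filterlim_tendsto_pos_mult_at_bot[OF tendsto_const p filterlim_ident])
  then have "((\<lambda>y. exp (p * y)) \<longlongrightarrow> 0) at_bot"
    by (rule filterlim_compose[OF exp_at_bot])
  then have "((\<lambda>y. exp (p * y) * M) \<longlongrightarrow> 0) at_bot"
    by (auto intro: tendsto_mult_left_zero)
  then have "exp (p * z) * f z \<le> 0"
    by (rule tendsto_lowerbound[OF _ ev]) simp
  then show ?thesis by (simp add: mult_le_0_iff)
qed

lemma bounded_supersolution_nonpos_right:
  fixes f f' :: "real \<Rightarrow> real"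
  assumes "p > 0" and df: "\<And>x. (f has_real_derivative f' x) (at x)"
    and sup: "\<And>x. f' x - p * f x \<ge> 0" and "\<And>x. f x \<le> M"
  shows "f z \<le> 0"
proof -
  have "f (- (- z)) \<le> 0"
  proof (rule bounded_subsolution_nonpos_left[where f = "\<lambda>x. f (- x)" and f' = "\<lambda>x. - f' (- x)"])
    show "((\<lambda>x. f (- x)) has_real_derivative - f' (- x)) (at x)" for x
      using DERIV_chain2[OF df[of "- x"] DERIV_minus[OF DERIV_ident]] by simp
    show "- f' (- x) + p * f (- x) \<le> 0" for x using sup[of "- x"] by simp
  qed (use assms in auto)
  then show ?thesis by simp
qed

context bistable_waves
begin

text \<open>
  To the right of the point where \<open>U = m\<close> both the reaction and the nonlocal term are nonnegative, so
  that \<open>D U' + c U\<close> decreases towards \<open>c r\<close> or more; this bounds the slope at that point from below by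
  \<open>c (r - m) / D\<close>. To the left \<open>D U'' + c U' \<le> \<Phi>\<close>, which bounds it from above by \<open>\<Phi> / c\<close>.
\<close>
lemma speed_le_of_nonneg_shift:
  assumes f: "front c U U' U''" and v: "v \<ge> 0"
    and \<Phi>: "\<And>u. l \<le> u \<Longrightarrow> u \<le> m \<Longrightarrow> g u \<ge> - \<Phi>"
  shows "c \<le> sqrt (\<Phi> * D / (r - m))"
proof (cases "c > 0")
  case False
  have "\<Phi> \<ge> 0" using \<Phi>[of m] g_m lm by simp
  then have "sqrt (\<Phi> * D / (r - m)) \<ge> 0" using D_pos mr by simp
  then show ?thesis using False by linarith
next
  case c: True
  have N: "\<gamma> * ((LBINT \<tau>:{0..}. \<Gamma> \<tau> * U (x + v * \<tau>)) - U x) \<ge> 0" for x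
  proof -
    have "U x \<le> U (x + v * \<tau>)" if "\<tau> \<ge> 0" for \<tau>
      using monoD[OF front_mono[OF f]] v that by simp
    then show ?thesis
      using kernel_average_ge[OF kernel front_integrable[OF f], of "U x" 0] \<gamma>_nonneg by simp
  qed
  obtain z where z: "U z = m" using front_attains[OF f lm mr] by blast
  have "c * r \<le> D * U' z + c * m"
  proof (rule tendsto_upperbound)
    show "((\<lambda>y. c * U y) \<longlongrightarrow> c * r) at_top" by (intro tendsto_intros front_at_top[OF f])
    have "c * U y \<le> D * U' z + c * m" if "z \<le> y" for y
    proof -
      have "D * U' y + c * U y \<le> D * U' z + c * U z"
      proof (rule DERIV_nonpos_imp_nonincreasing[OF that])
        fix x assume "z \<le> x"
        then have "g (U x) \<ge> 0"
          using monoD[OF front_mono[OF f], of z x] z front_le[OF f] by (intro g_right) auto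
        then have "D * U'' x + c * U' x \<le> 0" using front_equation[OF f, of x] N[of x] by linarith
        moreover have "((\<lambda>x. D * U' x + c * U x) has_real_derivative D * U'' x + c * U' x) (at x)"
          by (auto intro!: derivative_eq_intros front_deriv[OF f] front_deriv2[OF f])
        ultimately show "\<exists>d. ((\<lambda>x. D * U' x + c * U x) has_real_derivative d) (at x) \<and> d \<le> 0" by blast
      qed
      moreover have "D * U' y \<ge> 0" using D_pos front_deriv_nonneg[OF f] by simp
      ultimately show ?thesis using z by simp
    qed
    then show "\<forall>\<^sub>F y in at_top. c * U y \<le> D * U' z + c * m"
      by (auto simp: eventually_at_top_linorder)
  qed simp
  then have low: "c * (r - m) \<le> D * U' z" by (simp add: algebra_simps)
  obtain M where M: "\<And>x. U' x \<le> M" using front_deriv_bounded[OF f] by blast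
  have "U' z - \<Phi> / c \<le> 0"
  proof (rule bounded_subsolution_nonpos_left[where f = "\<lambda>x. U' x - \<Phi> / c" and p = "c / D"])
    show "((\<lambda>x. U' x - \<Phi> / c) has_real_derivative U'' x) (at x)" for x
      by (auto intro!: derivative_eq_intros front_deriv2[OF f])
    show "U'' x + c / D * (U' x - \<Phi> / c) \<le> 0" if "x \<le> z" for x
    proof -
      have "g (U x) \<ge> - \<Phi>"
        using monoD[OF front_mono[OF f] that] z front_ge[OF f] by (intro \<Phi>) auto
      then have "D * U'' x + c * U' x - \<Phi> \<le> 0" using front_equation[OF f, of x] N[of x] by linarith
      moreover have "D * U'' x + c * U' x - \<Phi> = D * (U'' x + c / D * (U' x - \<Phi> / c))"
        using D_pos c by (simp add: field_simps)
      ultimately show ?thesis using D_pos by (simp add: mult_le_0_iff)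
    qed
    show "U' x - \<Phi> / c \<le> M - \<Phi> / c" for x using M by simp
  qed (use c D_pos in simp)
  then have "D * U' z \<le> D * (\<Phi> / c)" using D_pos by (intro mult_left_mono) auto
  then have "c * (r - m) \<le> D * \<Phi> / c" using low by simp
  then have "c\<^sup>2 * (r - m) \<le> D * \<Phi>" using c by (simp add: field_simps power2_eq_square)
  then have "c\<^sup>2 \<le> \<Phi> * D / (r - m)" using mr by (simp add: field_simps)
  then show ?thesis by (rule real_le_rsqrt)
qed

text \<open>
  Let \<open>k = - c\<close>, let \<open>\<omega> = \<gamma> v\<close> times the first moment, and suppose that \<open>k - \<omega>\<close> exceeds the maximum.
  With \<open>M = sup U'\<close> the nonlocal term is at most \<open>\<omega> M\<close>, so \<open>D U'' - k U' \<ge> - (\<Phi> + \<omega> M)\<close>; hence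
  \<open>M \<le> (\<Phi> + \<omega> M) / k\<close>, that is, \<open>M (k - \<omega>) \<le> \<Phi>\<close>. On the other hand \<open>U'\<close> must outgrow the line
  \<open>\<mu> (U - b)\<close> on the part of the front where \<open>b \<le> U \<le> a\<close>: the function \<open>Z = U' - \<mu> (U - b)\<close> starts out
  nonnegative and satisfies \<open>D Z' \<ge> (k - D \<mu>) Z\<close> as long as \<open>D \<mu> \<le> k - \<omega>\<close> and \<open>\<omega> \<mu> \<le> \<alpha>\<close>. The
  assumption on \<open>k - \<omega>\<close> is what leaves room for such a \<open>\<mu>\<close> with \<open>M < \<mu> (a - b)\<close>, and then \<open>Z\<close> is
  negative where \<open>U = a\<close>.
\<close>
lemma speed_ge_of_nonneg_shift:
  assumes f: "front c U U' U''" and v: "v \<ge> 0"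
    and \<Phi>: "\<And>u. m \<le> u \<Longrightarrow> u \<le> r \<Longrightarrow> g u \<le> \<Phi>"
    and b: "l \<le> b" and ba: "b < a" and a: "a \<le> m" and \<alpha>: "\<alpha> > 0"
    and lin: "\<And>u. b \<le> u \<Longrightarrow> u \<le> a \<Longrightarrow> g u \<le> \<alpha> * (u - a)"
  shows "- max (sqrt (\<Phi> * D / (a - b))) (\<Phi> * \<gamma> * first_moment \<Gamma> * v / (\<alpha> * (a - b)))
           - \<gamma> * first_moment \<Gamma> * v \<le> c"
proof (rule ccontr)
  define k where "k = - c"
  define \<omega> where "\<omega> = \<gamma> * first_moment \<Gamma> * v"
  assume "\<not> ?thesis"
  then have k1: "k - \<omega> > sqrt (\<Phi> * D / (a - b))"
    and k2': "k - \<omega> > \<Phi> * \<gamma> * first_moment \<Gamma> * v / (\<alpha> * (a - b))"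
    by (auto simp: k_def \<omega>_def)
  then have k2: "k - \<omega> > \<Phi> * \<omega> / (\<alpha> * (a - b))"
    by (simp add: \<omega>_def mult.assoc)
  have \<Phi>_nonneg: "\<Phi> \<ge> 0" using \<Phi>[of m] g_m mr by simp
  have \<omega>_nonneg: "\<omega> \<ge> 0"
    unfolding \<omega>_def using \<gamma>_nonneg v first_moment_nonneg[OF kernel] by simp
  have "sqrt (\<Phi> * D / (a - b)) \<ge> 0" using \<Phi>_nonneg D_pos ba by simp
  then have k\<omega>: "k - \<omega> > 0" using k1 by linarith
  then have k_pos: "k > 0" using \<omega>_nonneg by simp
  have eq: "D * U'' x - k * U' x = - g (U x) - \<gamma> * ((LBINT \<tau>:{0..}. \<Gamma> \<tau> * U (x + v * \<tau>)) - U x)" for x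
    using front_equation[OF f, of x] by (simp add: k_def)

  define M where "M = Sup (range U')"
  have "bdd_above (range U')" using front_deriv_bounded[OF f] by (auto intro: bdd_aboveI2)
  then have M: "U' x \<le> M" for x unfolding M_def by (intro cSup_upper) auto
  have M_nonneg: "M \<ge> 0" using M[of 0] front_deriv_nonneg[OF f, of 0] by simp
  have N: "\<gamma> * ((LBINT \<tau>:{0..}. \<Gamma> \<tau> * U (x + v * \<tau>)) - U x) \<le> \<omega> * M" for x
  proof -
    have "U (x + v * \<tau>) \<le> U x + M * v * \<tau>" if "\<tau> \<ge> 0" for \<tau>
    proof -
      have "U (x + v * \<tau>) - M * (x + v * \<tau>) \<le> U x - M * x"
      proof (rule DERIV_nonpos_imp_nonincreasing[where f = "\<lambda>x. U x - M * x"])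
        fix y
        have "((\<lambda>x. U x - M * x) has_real_derivative U' y - M) (at y)"
          by (auto intro!: derivative_eq_intros front_deriv[OF f])
        then show "\<exists>d. ((\<lambda>x. U x - M * x) has_real_derivative d) (at y) \<and> d \<le> 0"
          using M[of y] by (intro exI[of _ "U' y - M"]) simp
      qed (use v that in simp)
      then show ?thesis by (simp add: algebra_simps)
    qed
    then have "(LBINT \<tau>:{0..}. \<Gamma> \<tau> * U (x + v * \<tau>)) \<le> U x + M * v * first_moment \<Gamma>"
      by (intro kernel_average_le[OF kernel front_integrable[OF f]])
    then have "\<gamma> * ((LBINT \<tau>:{0..}. \<Gamma> \<tau> * U (x + v * \<tau>)) - U x) \<le> \<gamma> * (M * v * first_moment \<Gamma>)"
      using \<gamma>_nonneg by (intro mult_left_mono) auto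
    then show ?thesis by (simp add: \<omega>_def mult_ac)
  qed
  have g_le: "g (U x) \<le> \<Phi>" for x
    using \<Phi>[of "U x"] g_left[of "U x"] front_ge[OF f, of x] front_le[OF f, of x] \<Phi>_nonneg
    by (cases "U x \<le> m") auto
  define B where "B = \<Phi> + \<omega> * M"
  have B_nonneg: "B \<ge> 0" using \<Phi>_nonneg \<omega>_nonneg M_nonneg by (simp add: B_def)
  have "U' x \<le> B / k" for x
  proof -
    have "U' x - B / k \<le> 0"
    proof (rule bounded_supersolution_nonpos_right[where f = "\<lambda>x. U' x - B / k" and p = "k / D"])
      show "((\<lambda>x. U' x - B / k) has_real_derivative U'' x) (at x)" for x
        by (auto intro!: derivative_eq_intros front_deriv2[OF f])
      show "U'' x - k / D * (U' x - B / k) \<ge> 0" for x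
      proof -
        have "D * U'' x - k * U' x + B \<ge> 0" using eq[of x] N[of x] g_le[of x] by (simp add: B_def)
        moreover have "D * U'' x - k * U' x + B = D * (U'' x - k / D * (U' x - B / k))"
          using D_pos k_pos by (simp add: field_simps)
        ultimately show ?thesis using D_pos by (simp add: zero_le_mult_iff)
      qed
      show "U' x - B / k \<le> M - B / k" for x using M by simp
    qed (use k_pos D_pos in simp)
    then show ?thesis by simp
  qed
  then have "M \<le> B / k" unfolding M_def by (intro cSup_least) auto
  then have Mk: "M * (k - \<omega>) \<le> \<Phi>" using k_pos by (simp add: B_def field_simps)

  have n: "a - b > 0" using ba by simp
  have DM: "D * M < (k - \<omega>) * (a - b)"
  proof -
    have "\<Phi> * D / (a - b) < (k - \<omega>)\<^sup>2"
      using k1 k\<omega> real_less_lsqrt by (metis less_imp_le not_less real_le_rsqrt)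
    then have "\<Phi> * D < (k - \<omega>)\<^sup>2 * (a - b)" using n by (simp add: pos_divide_less_eq)
    moreover have "M * (k - \<omega>) * D \<le> \<Phi> * D" using Mk D_pos by simp
    ultimately have "(k - \<omega>) * (D * M) < (k - \<omega>) * ((k - \<omega>) * (a - b))"
      by (simp add: power2_eq_square mult_ac)
    then show ?thesis using k\<omega> by (simp only: mult_less_cancel_left_pos)
  qed
  have \<omega>M: "\<omega> * M < \<alpha> * (a - b)"
  proof -
    have "\<Phi> * \<omega> < (k - \<omega>) * (\<alpha> * (a - b))" using k2 n \<alpha> by (simp add: pos_divide_less_eq)
    moreover have "M * (k - \<omega>) * \<omega> \<le> \<Phi> * \<omega>" using Mk \<omega>_nonneg by (intro mult_right_mono)
    ultimately have "(k - \<omega>) * (\<omega> * M) < (k - \<omega>) * (\<alpha> * (a - b))" by (simp add: mult_ac)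
    then show ?thesis using k\<omega> by (simp only: mult_less_cancel_left_pos)
  qed
  \<comment> \<open>The critical slope is \<open>M / (a - b)\<close>; it is enlarged to make the inequality at \<open>a\<close> strict.\<close>
  obtain \<mu> where \<mu>: "M < \<mu> * (a - b)" "D * \<mu> \<le> k - \<omega>" "\<omega> * \<mu> \<le> \<alpha>"
  proof -
    define \<mu>\<^sub>0 where "\<mu>\<^sub>0 = M / (a - b)"
    have "\<mu>\<^sub>0 < (k - \<omega>) / D" "\<omega> * \<mu>\<^sub>0 < \<alpha>"
      using DM \<omega>M n D_pos by (simp_all add: \<mu>\<^sub>0_def field_simps)
    define \<epsilon> where "\<epsilon> = min ((k - \<omega>) / D - \<mu>\<^sub>0) ((\<alpha> - \<omega> * \<mu>\<^sub>0) / (\<omega> + 1))"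
    have \<epsilon>: "\<epsilon> > 0" "\<epsilon> \<le> (k - \<omega>) / D - \<mu>\<^sub>0" "\<epsilon> \<le> (\<alpha> - \<omega> * \<mu>\<^sub>0) / (\<omega> + 1)"
      using \<open>\<mu>\<^sub>0 < (k - \<omega>) / D\<close> \<open>\<omega> * \<mu>\<^sub>0 < \<alpha>\<close> \<omega>_nonneg by (auto simp: \<epsilon>_def)
    have "M = \<mu>\<^sub>0 * (a - b)" using n by (simp add: \<mu>\<^sub>0_def)
    then have "M < (\<mu>\<^sub>0 + \<epsilon>) * (a - b)" using \<epsilon>(1) n by simp
    moreover have "D * (\<mu>\<^sub>0 + \<epsilon>) \<le> k - \<omega>" using \<epsilon>(2) D_pos by (simp add: field_simps)
    moreover have "\<epsilon> * (\<omega> + 1) \<le> \<alpha> - \<omega> * \<mu>\<^sub>0"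
      using \<epsilon>(3) \<omega>_nonneg by (simp add: pos_le_divide_eq)
    then have "\<omega> * (\<mu>\<^sub>0 + \<epsilon>) \<le> \<alpha>" using \<epsilon>(1) by (simp add: algebra_simps)
    ultimately show ?thesis using that by blast
  qed
  have "\<mu> * (a - b) > 0" using \<mu>(1) M_nonneg by linarith
  then have \<mu>_pos: "\<mu> > 0" using n by (simp add: zero_less_mult_iff)

  \<comment> \<open>The linear bound is negative at \<open>l\<close>, where \<open>g\<close> vanishes; so the front attains \<open>b\<close> at a finite point.\<close>
  have "b \<noteq> l"
  proof
    assume "b = l"
    then have "0 \<le> \<alpha> * (l - a)" using lin[of l] g_l ba by simp
    then show False using \<alpha> ba \<open>b = l\<close> by (simp add: zero_le_mult_iff)
  qed
  then obtain xb where xb: "U xb = b" using front_attains[OF f, of b] b ba a mr by auto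
  obtain xa where xa: "U xa = a" using front_attains[OF f, of a] b ba a mr by auto
  have "xb \<le> xa"
    using monoD[OF front_mono[OF f], of xa xb] xa xb ba by linarith
  define Z where "Z x = U' x - \<mu> * (U x - b)" for x
  define p where "p = (k - D * \<mu>) / D"
  have Dp: "D * p = k - D * \<mu>" using D_pos by (simp add: p_def)
  have dZ: "(Z has_real_derivative U'' x - \<mu> * U' x) (at x)" for x
    unfolding Z_def by (auto intro!: derivative_eq_intros front_deriv[OF f] front_deriv2[OF f])
  have "exp (- p * xb) * Z xb \<le> exp (- p * xa) * Z xa"
  proof (rule DERIV_nonneg_imp_nondecreasing[OF \<open>xb \<le> xa\<close>])
    fix x assume x: "xb \<le> x" "x \<le> xa"
    have Ux: "b \<le> U x" "U x \<le> a"
      using monoD[OF front_mono[OF f] x(1)] monoD[OF front_mono[OF f] x(2)] xa xb by simp_all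
    have "\<omega> * M \<le> \<omega> * (\<mu> * (a - b))" using \<mu>(1) \<omega>_nonneg by (intro mult_left_mono) auto
    then have "D * U'' x - k * U' x \<ge> \<alpha> * (a - U x) - \<omega> * \<mu> * (a - b)"
      using eq[of x] N[of x] lin[OF Ux] by (simp add: algebra_simps)
    moreover have "D * (U'' x - \<mu> * U' x - p * Z x) = D * U'' x - D * \<mu> * U' x - (k - D * \<mu>) * Z x"
      unfolding Dp[symmetric] by (simp add: algebra_simps)
    ultimately have "D * (U'' x - \<mu> * U' x - p * Z x)
        \<ge> (\<alpha> - \<omega> * \<mu>) * (a - U x) + (k - D * \<mu> - \<omega>) * \<mu> * (U x - b)"
      by (simp add: Z_def algebra_simps)
    moreover have "(\<alpha> - \<omega> * \<mu>) * (a - U x) \<ge> 0" "(k - D * \<mu> - \<omega>) * \<mu> * (U x - b) \<ge> 0"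
      using \<mu> \<mu>_pos Ux by simp_all
    ultimately have "D * (U'' x - \<mu> * U' x - p * Z x) \<ge> 0" by linarith
    then have "exp (- p * x) * (U'' x - \<mu> * U' x - p * Z x) \<ge> 0"
      using D_pos by (simp add: zero_le_mult_iff)
    moreover have "((\<lambda>x. exp (- p * x) * Z x) has_real_derivative
        exp (- p * x) * (U'' x - \<mu> * U' x - p * Z x)) (at x)"
      by (auto intro!: derivative_eq_intros dZ simp: algebra_simps)
    ultimately show "\<exists>d. ((\<lambda>x. exp (- p * x) * Z x) has_real_derivative d) (at x) \<and> d \<ge> 0" by blast
  qed
  moreover have "Z xb \<ge> 0" using front_deriv_nonneg[OF f] by (simp add: Z_def xb)
  ultimately have "exp (- p * xa) * Z xa \<ge> 0" by (meson exp_ge_zero mult_nonneg_nonneg order_trans)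
  then have "Z xa \<ge> 0" by (simp add: zero_le_mult_iff)
  then show False using M[of xa] \<mu>(1) by (simp add: Z_def xa)
qed

end

section \<open>The reaction term of a bistable nonlinearity\<close>

lemma strictly_decreasing_near:
  fixes f f' :: "real \<Rightarrow> real"
  assumes df: "\<And>x. (f has_real_derivative f' x) (at x)" and cont: "isCont f' u" and neg: "f' u < 0"
  shows "\<exists>\<delta>>0. \<forall>x y. u - \<delta> \<le> x \<longrightarrow> x < y \<longrightarrow> y \<le> u + \<delta> \<longrightarrow> f y < f x"
proof -
  have "\<forall>\<^sub>F x in nhds u. f' x < 0"
    using cont neg by (auto simp: isCont_def tendsto_at_iff_tendsto_nhds intro: order_tendstoD(2))
  then obtain d where d: "d > 0" "\<And>x. dist x u < d \<Longrightarrow> f' x < 0"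
    unfolding eventually_nhds_metric by blast
  have "f y < f x" if "u - d / 2 \<le> x" "x < y" "y \<le> u + d / 2" for x y
  proof (rule DERIV_neg_imp_decreasing[OF that(2)])
    fix t assume "x \<le> t" "t \<le> y"
    then have "f' t < 0" using that d(1) by (intro d(2)) (auto simp: dist_real_def abs_if)
    then show "\<exists>s. (f has_real_derivative s) (at t) \<and> s < 0" using df by blast
  qed
  then show ?thesis using d(1) by (intro exI[of _ "d / 2"]) auto
qed

lemma positive_on_connected:
  fixes f :: "real \<Rightarrow> real"
  assumes "connected S" and cont: "continuous_on S f" and "\<And>x. x \<in> S \<Longrightarrow> f x \<noteq> 0"
    and "x \<in> S" "f x > 0" "y \<in> S"
  shows "f y > 0"
proof (rule ccontr)
  assume "\<not> f y > 0"
  then have "0 \<in> f ` S"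
    using connectedD_interval[OF connected_continuous_image[OF cont \<open>connected S\<close>], of "f y" "f x" 0] assms
    by auto
  then show False using assms(3) by auto
qed

text \<open>
  The outer zeros have negative slope and there are no others than the three, which fixes the sign of
  the reaction on each of the four intervals.
\<close>
lemma bistable_reaction:
  assumes D: "D > 0" and bi: "bistable F \<gamma>_max u_minus u_mid u_plus"
    and kernel: "delay_kernel \<Gamma>" and \<gamma>: "\<gamma> \<in> {0..\<gamma>_max}"
  shows "\<exists>\<delta> L. bistable_waves D \<gamma> \<Gamma> (shifted F \<gamma>) (u_minus \<gamma>) (u_mid \<gamma>) (u_plus \<gamma>) \<delta> L"
proof -
  define g where "g = shifted F \<gamma>"
  define l m r where "l = u_minus \<gamma>" and "m = u_mid \<gamma>" and "r = u_plus \<gamma>"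
  have C2: "C2 F" and zeros: "{u. g u = 0} = {l, m, r}" and lm: "l < m" and mr: "m < r"
    and dl: "deriv g l < 0" and dr: "deriv g r < 0"
    using bi \<gamma> unfolding bistable_def g_def l_def m_def r_def by auto
  have zero_iff: "g u = 0 \<longleftrightarrow> u = l \<or> u = m \<or> u = r" for u using zeros by blast
  define g' where "g' x = deriv F x + \<gamma>" for x
  have dg: "(g has_real_derivative g' x) (at x)" for x
    using C2 unfolding g_def shifted_def[abs_def] g'_def C2_def
    by (auto intro!: derivative_eq_intros simp: DERIV_deriv_iff_real_differentiable)
  have cont_g': "isCont g' x" for x
  proof -
    have "isCont (deriv F) x"
      using C2 unfolding C2_def by (auto intro: differentiable_imp_continuous_within)
    then show ?thesis unfolding g'_def by (intro continuous_intros)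
  qed
  have cont: "continuous_on S g" for S
    by (meson DERIV_continuous_on dg has_field_derivative_at_within)
  have "g' l < 0" "g' r < 0" using dl dr DERIV_imp_deriv[OF dg] by simp_all
  then obtain \<delta>1 \<delta>2 where \<delta>12: "\<delta>1 > 0" "\<delta>2 > 0"
    and dec1: "\<And>x y. l - \<delta>1 \<le> x \<Longrightarrow> x < y \<Longrightarrow> y \<le> l + \<delta>1 \<Longrightarrow> g y < g x"
    and dec2: "\<And>x y. r - \<delta>2 \<le> x \<Longrightarrow> x < y \<Longrightarrow> y \<le> r + \<delta>2 \<Longrightarrow> g y < g x"
    using strictly_decreasing_near[OF dg cont_g', of l] strictly_decreasing_near[OF dg cont_g', of r]
    by blast
  define \<delta> where "\<delta> = min (min \<delta>1 \<delta>2) (min ((m - l) / 2) ((r - m) / 2))"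
  have \<delta>: "\<delta> > 0" "\<delta> \<le> \<delta>1" "\<delta> \<le> \<delta>2" "l + \<delta> < m" "m < r - \<delta>"
    using \<delta>12 lm mr by (auto simp: \<delta>_def min_def field_simps)
  have gl: "g l = 0" and gm: "g m = 0" and gr: "g r = 0" using zero_iff by auto
  have pos1: "g (l - \<delta>) > 0" using dec1[of "l - \<delta>" l] \<delta> gl by simp
  have neg2: "g (l + \<delta>) < 0" using dec1[of l "l + \<delta>"] \<delta> gl by simp
  have pos3: "g (r - \<delta>) > 0" using dec2[of "r - \<delta>" r] \<delta> gr by simp
  have neg4: "g (r + \<delta>) < 0" using dec2[of r "r + \<delta>"] \<delta> gr by simp
  have below: "g u > 0" if "u < l" for u
    by (rule positive_on_connected[of "{..<l}" g "l - \<delta>"])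
       (use that pos1 \<delta> zero_iff cont lm mr in auto)
  have left: "- g u > 0" if "l < u" "u < m" for u
    by (rule positive_on_connected[of "{l<..<m}" "\<lambda>u. - g u" "l + \<delta>"])
       (use that neg2 \<delta> zero_iff lm mr in \<open>auto intro!: continuous_intros cont\<close>)
  have right: "g u > 0" if "m < u" "u < r" for u
    by (rule positive_on_connected[of "{m<..<r}" g "r - \<delta>"])
       (use that pos3 \<delta> zero_iff cont lm mr in auto)
  have above: "- g u > 0" if "r < u" for u
    by (rule positive_on_connected[of "{r<..}" "\<lambda>u. - g u" "r + \<delta>"])
       (use that neg4 \<delta> zero_iff lm mr in \<open>auto intro!: continuous_intros cont\<close>)
  have "continuous_on {l..r} g'" by (intro continuous_at_imp_continuous_on ballI cont_g')
  then have "bounded (g' ` {l..r})"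
    by (intro compact_imp_bounded compact_continuous_image) auto
  then obtain L where L: "L > 0" "\<And>x. x \<in> {l..r} \<Longrightarrow> \<bar>g' x\<bar> \<le> L"
    unfolding bounded_pos by auto
  have lip: "\<bar>g y - g x\<bar> \<le> L * (y - x)" if "l \<le> x" "x \<le> y" "y \<le> r" for x y
  proof (cases "x = y")
    case False
    then have "x < y" using that by simp
    then obtain t where t: "x < t" "t < y" "g y - g x = (y - x) * g' t"
      using MVT2[of x y g g', OF _ dg] by blast
    then have "\<bar>g y - g x\<bar> = (y - x) * \<bar>g' t\<bar>" using that by (simp add: abs_mult)
    also have "\<dots> \<le> (y - x) * L" using that t by (intro mult_left_mono L) auto
    finally show ?thesis by (simp add: mult.commute)
  qed simp
  have "bistable_waves D \<gamma> \<Gamma> g l m r \<delta> L"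
  proof unfold_locales
    show "g u \<le> 0" if "l \<le> u" "u \<le> m" for u
      using left[of u] gl gm that by (cases "u = l \<or> u = m") auto
    show "0 \<le> g u" if "m \<le> u" "u \<le> r" for u
      using right[of u] gm gr that by (cases "u = m \<or> u = r") auto
    show "g u < 0" if "r < u" for u using above[OF that] by simp
    show "g y < g x" if "l \<le> x" "x < y" "y \<le> l + \<delta>" for x y
      using dec1[of x y] that \<delta> by simp
    show "g y < g x" if "r - \<delta> \<le> x" "x < y" "y \<le> r" for x y
      using dec2[of x y] that \<delta> by simp
  qed (use D \<gamma> kernel lm mr gl gr \<delta> L lip below in auto)
  then show ?thesis unfolding g_def l_def m_def r_def by blast
qed

section \<open>Bounds for the wave speed\<close>

theorem theorem2p5:
  fixes D \<gamma>_max \<gamma> v :: real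
    and F \<Gamma> u_minus u_mid u_plus :: "real \<Rightarrow> real"
    and Phi_lo Phi_up a_lo b_lo \<alpha>_lo a_up b_up \<alpha>_up :: real
  assumes "D > 0"
    and "bistable F \<gamma>_max u_minus u_mid u_plus"
    and "delay_kernel \<Gamma>"
    and "\<gamma> \<in> {0..\<gamma>_max}"
    and front: "\<exists>U c. traveling_front D F \<Gamma> \<gamma> v (u_minus \<gamma>) (u_plus \<gamma>) U c"
    and "\<forall>u\<in>{u_minus \<gamma>..u_mid \<gamma>}. shifted F \<gamma> u \<ge> - Phi_lo"
    and "\<forall>u\<in>{u_mid \<gamma>..u_plus \<gamma>}. shifted F \<gamma> u \<le> Phi_up"
    and "a_lo \<in> {u_mid \<gamma>..u_plus \<gamma>}" and "b_lo \<in> {u_mid \<gamma>..u_plus \<gamma>}"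
    and "a_lo < b_lo" and "\<alpha>_lo > 0"
    and "\<forall>u\<in>{a_lo..b_lo}. shifted F \<gamma> u \<ge> \<alpha>_lo * (u - a_lo)"
    and "a_up \<in> {u_minus \<gamma>..u_mid \<gamma>}" and "b_up \<in> {u_minus \<gamma>..u_mid \<gamma>}"
    and "b_up < a_up" and "\<alpha>_up > 0"
    and "\<forall>u\<in>{b_up..a_up}. shifted F \<gamma> u \<le> \<alpha>_up * (u - a_up)"
  defines "C \<equiv> wave_speed D F \<Gamma> \<gamma> v (u_minus \<gamma>) (u_plus \<gamma>)"
    and "g1 \<equiv> first_moment \<Gamma>"
  shows "(v \<ge> 0 \<longrightarrow>
            - max (sqrt (Phi_up * D / (a_up - b_up)))
                  (Phi_up * \<gamma> * g1 * v / (\<alpha>_up * (a_up - b_up)))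
              - \<gamma> * g1 * v \<le> C \<and>
            C \<le> sqrt (Phi_lo * D / (u_plus \<gamma> - u_mid \<gamma>))) \<and>
         (v \<le> 0 \<longrightarrow>
            - sqrt (Phi_up * D / (u_mid \<gamma> - u_minus \<gamma>)) \<le> C \<and>
            C \<le> max (sqrt (Phi_lo * D / (b_lo - a_lo)))
                    (Phi_lo * \<gamma> * g1 * \<bar>v\<bar> / (\<alpha>_lo * (b_lo - a_lo)))
                  + \<gamma> * g1 * \<bar>v\<bar>)"
proof -
  define g l m r where "g = shifted F \<gamma>" and "l = u_minus \<gamma>" and "m = u_mid \<gamma>" and "r = u_plus \<gamma>"
  obtain \<delta> L where "bistable_waves D \<gamma> \<Gamma> g l m r \<delta> L"
    using bistable_reaction[OF assms(1-4)] unfolding g_def l_def m_def r_def by blast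
  then interpret bistable_waves D \<gamma> v \<Gamma> g l m r \<delta> L .
  obtain U c where tf: "traveling_front D F \<Gamma> \<gamma> v l r U c"
    using front unfolding l_def r_def by blast
  have f: "profile D \<gamma> v \<Gamma> g l r c U (deriv U) (deriv (deriv U))"
    using traveling_front_profile[OF tf] by (simp add: g_def)
  have "C = c"
    unfolding C_def wave_speed_def l_def[symmetric] r_def[symmetric]
  proof (rule the_equality)
    show "\<exists>U. traveling_front D F \<Gamma> \<gamma> v l r U c" using tf by blast
    fix c' assume "\<exists>U. traveling_front D F \<Gamma> \<gamma> v l r U c'"
    then obtain U' where "traveling_front D F \<Gamma> \<gamma> v l r U' c'" by blast
    from traveling_front_profile[OF this]
    have "profile D \<gamma> v \<Gamma> g l r c' U' (deriv U') (deriv (deriv U'))" by (simp add: g_def)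
    then show "c' = c" using front_speed_unique f by blast
  qed
  note lower = assms(6)[folded g_def l_def m_def r_def] and upper = assms(7)[folded g_def l_def m_def r_def]
    and a_lo = assms(8)[folded l_def m_def r_def] and b_lo = assms(9)[folded l_def m_def r_def]
    and lin_lo = assms(12)[folded g_def]
    and a_up = assms(13)[folded l_def m_def r_def] and b_up = assms(14)[folded l_def m_def r_def]
    and lin_up = assms(17)[folded g_def]
  \<comment> \<open>The bounds for \<open>v \<le> 0\<close> are those for \<open>v \<ge> 0\<close>, applied to the reflected profile \<open>- U (- x)\<close>.\<close>
  interpret refl: bistable_waves D \<gamma> "- v" \<Gamma> "\<lambda>u. - g (- u)" "- r" "- m" "- l" \<delta> L
    by (rule reflected)
  note f' = profile_reflect[OF f]
  have "c \<le> sqrt (Phi_lo * D / (r - m))" if "v \<ge> 0"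
    by (rule speed_le_of_nonneg_shift[OF f that]) (use lower in auto)
  moreover have "- max (sqrt (Phi_up * D / (a_up - b_up)))
      (Phi_up * \<gamma> * g1 * v / (\<alpha>_up * (a_up - b_up))) - \<gamma> * g1 * v \<le> c" if "v \<ge> 0"
    unfolding g1_def
    by (rule speed_ge_of_nonneg_shift[OF f that]) (use upper a_up b_up lin_up assms(15,16) in auto)
  moreover have "- sqrt (Phi_up * D / (m - l)) \<le> c" if "v \<le> 0"
  proof -
    have "- c \<le> sqrt (Phi_up * D / (- l - - m))"
      by (rule refl.speed_le_of_nonneg_shift[OF f']) (use upper that in auto)
    then show ?thesis by simp
  qed
  moreover have "c \<le> max (sqrt (Phi_lo * D / (b_lo - a_lo)))
      (Phi_lo * \<gamma> * g1 * \<bar>v\<bar> / (\<alpha>_lo * (b_lo - a_lo))) + \<gamma> * g1 * \<bar>v\<bar>" if "v \<le> 0"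
  proof -
    have "- max (sqrt (Phi_lo * D / (- a_lo - - b_lo)))
        (Phi_lo * \<gamma> * g1 * (- v) / (\<alpha>_lo * (- a_lo - - b_lo))) - \<gamma> * g1 * (- v) \<le> - c"
      unfolding g1_def
    proof (rule refl.speed_ge_of_nonneg_shift[OF f'])
      show "- g (- u) \<le> Phi_lo" if "- m \<le> u" "u \<le> - l" for u
        using bspec[OF lower, of "- u"] that by simp
      show "- g (- u) \<le> \<alpha>_lo * (u - - a_lo)" if "- b_lo \<le> u" "u \<le> - a_lo" for u
        using bspec[OF lin_lo, of "- u"] that by (simp add: algebra_simps)
    qed (use a_lo b_lo assms(10,11) that in auto)
    then show ?thesis using that by simp
  qed
  ultimately show ?thesis
    unfolding \<open>C = c\<close> l_def m_def r_def by blast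
qed

end
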